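(* The algorithm GmaxGens (described in the context), which takes as input the $m\times n$ exponent matrix $A$ of an admissible polynomial $W\in\mathbb{C}[x_1,\dots,x_n]$ and computes generators of $G_W^{\max}$, runs in polynomial time; that is, its running time (number of bit operations) is bounded by a polynomial in $m$, $n$ and $\|A\|$, where $\|A\| = \max_{i,j} a_{ij}$.
   Context: A polynomial $W \in \mathbb{C}[x_1,\dots,x_n]$ is nondegenerate if it has an isolated critical point at the origin. It is quasihomogeneous if there are positive rational numbers $q_1,\dots,q_n$ (the weights) with $W(c^{q_1}x_1,\dots,c^{q_n}x_n) = cW(x_1,\dots,x_n)$ for all $c\in\mathbb{C}$; equivalently, every monomial $x_1^{a_1}\cdots x_n^{a_n}$ of $W$ satisfies $\sum_j a_j q_j = 1$. $W$ is admissible if it is nondegenerate, quasihomogeneous with unique weights, and has no monomials of the form $x_i x_j$ with $i \neq j$. Writing $W = \sum_{i=1}^m c_i \prod_{j=1}^n x_j^{a_{ij}}$ as a sum of its $m$ distinct monomials (with $c_i\neq0$), the exponent matrix is the $m\times n$ nonnegative integer matrix $A=(a_{ij})$; for admissible $W$ one has $m\ge n$ and $A$ has rank $n$. The maximal symmetry group in additive notation is $G_W^{\max}=\{\mathbf{g}\in(\mathbb{Q}/\mathbb{Z})^n\mid A\mathbf{g}\in\mathbb{Z}^m\}$. The input $A$ is considered to be of polynomial size in $n$ if both $m$ and $\|A\|$ are of polynomial size in $n$. The Smith normal form of an $m\times n$ integer matrix $M$ of rank $n$ is the $m\times n$ integer matrix $S=PMQ$ with $P$ ($m\times m$) and $Q$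 ($n\times n$) invertible over $\mathbb{Z}$, whose first $n$ rows form $\mathrm{diag}(a_1,\dots,a_n)$ with positive integers $a_{i-1}\mid a_i$ (the invariant factors), and whose remaining rows are zero. Algorithm GmaxGens, on input $A$: 1. Compute the Smith normal form $S = PAQ$, with invariant factors $a_1,\dots,a_n$. 2. Scale the $i$th column of $Q$ by $1/a_i$ for each $i$ with $a_i\ne1$. 3. Return the scaled columns of $Q$. Step 1 is carried out by a known deterministic polynomial-time algorithm (Storjohann 1996), whose running time on an $m\times n$ integer matrix $A$ is $O^{\sim}(m^{\theta-1}n\cdot B(m\log\|A\|))$, where two $m\times m$ matrices can be multiplied in $O(m^\theta)$ steps over $\mathbb{Z}$, $B(t)$ bounds the cost of multiplying two $\lceil t\rceil$-bit integers, and $f\in O^{\sim}(g)$ means $f\in O(g\log^k g)$ for some $k$. *)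

theory Defs
  imports
    "HOL-Analysis.Complex_Transcendental"
    "HOL-Library.Poly_Mapping"
    "HOL-Library.Log_Nat"
    "HOL-Library.Landau_Symbols"
    "HOL-Algebra.Generated_Groups"
    "Jordan_Normal_Form.DL_Rank"
begin

hide_type (open) Finite_Cartesian_Product.vec
hide_const (open) Finite_Cartesian_Product.vec
no_notation Finite_Cartesian_Product.vec_nth (infixl "$" 90)

section \<open>Admissible polynomials\<close>

text \<open>
  A polynomial in \<open>x\<^sub>0, \<dots>, x\<^bsub>n-1\<^esub>\<close> maps monomials (finitely supported exponent vectors) to their
  coefficients. Points of affine space are functions on all of \<open>nat\<close>, of which only the first
  \<open>n\<close> values matter.
\<close>

type_synonym monomial = "nat \<Rightarrow>\<^sub>0 nat"
type_synonym cpoly = "monomial \<Rightarrow>\<^sub>0 complex"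

definition in_vars :: "nat \<Rightarrow> cpoly \<Rightarrow> bool" where
  "in_vars n W \<longleftrightarrow> (\<forall>a \<in> Poly_Mapping.keys W. Poly_Mapping.keys a \<subseteq> {..<n})"

definition peval :: "cpoly \<Rightarrow> (nat \<Rightarrow> complex) \<Rightarrow> complex" where
  "peval W x = (\<Sum>a \<in> Poly_Mapping.keys W. Poly_Mapping.lookup W a * (\<Prod>j \<in> Poly_Mapping.keys a. x j ^ Poly_Mapping.lookup a j))"

definition critical_point :: "nat \<Rightarrow> cpoly \<Rightarrow> (nat \<Rightarrow> complex) \<Rightarrow> bool" where
  "critical_point n W x \<longleftrightarrow> (\<forall>i<n. deriv (\<lambda>z. peval W (x(i := z))) (x i) = 0)"

definition nondegenerate :: "nat \<Rightarrow> cpoly \<Rightarrow> bool" where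
  "nondegenerate n W \<longleftrightarrow>
     critical_point n W (\<lambda>_. 0) \<and>
     (\<exists>\<epsilon>>0. \<forall>x. (\<forall>i<n. norm (x i) < \<epsilon>) \<and> critical_point n W x \<longrightarrow> (\<forall>i<n. x i = 0))"

text \<open>
  \<open>c powr q\<close> is the principal value (and \<open>0\<close> for \<open>c = 0\<close>). With it the identity below holds for
  all \<open>c\<close> iff every monomial \<open>a\<close> of \<open>W\<close> satisfies \<open>(\<Sum>j<n. a j * q j) = 1\<close>.
\<close>

definition is_weights :: "nat \<Rightarrow> cpoly \<Rightarrow> (nat \<Rightarrow> rat) \<Rightarrow> bool" where
  "is_weights n W q \<longleftrightarrow>
     (\<forall>j<n. 0 < q j) \<and>
     (\<forall>c x. peval W (\<lambda>j. c powr of_rat (q j) * x j) = c * peval W x)"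

definition admissible :: "nat \<Rightarrow> cpoly \<Rightarrow> bool" where
  "admissible n W \<longleftrightarrow>
     in_vars n W \<and> nondegenerate n W \<and>
     (\<exists>q. is_weights n W q) \<and>
     (\<forall>q q'. is_weights n W q \<and> is_weights n W q' \<longrightarrow> (\<forall>j<n. q j = q' j)) \<and>
     (\<forall>i j. i \<noteq> j \<longrightarrow> Poly_Mapping.single i 1 + Poly_Mapping.single j 1 \<notin> Poly_Mapping.keys W)"

text \<open>The order of the monomials, i.e.\ of the rows, is arbitrary.\<close>

definition exponent_matrix :: "nat \<Rightarrow> cpoly \<Rightarrow> int mat \<Rightarrow> bool" where
  "exponent_matrix n W A \<longleftrightarrow>
     (\<exists>ms. distinct ms \<and> set ms = Poly_Mapping.keys W \<and>
        A = mat (length ms) n (\<lambda>(i, j). int (Poly_Mapping.lookup (ms ! i) j)))"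

definition mat_norm :: "int mat \<Rightarrow> int" where
  "mat_norm A = Max (abs ` elements_mat A)"


section \<open>The maximal symmetry group\<close>

text \<open>\<open>QZ n\<close> is \<open>(\<rat>/\<int>)\<^sup>n\<close>, as the additive group \<open>\<rat>\<^sup>n\<close> modulo \<open>\<int>\<^sup>n\<close>.\<close>

definition int_vecs :: "nat \<Rightarrow> rat vec set" where
  "int_vecs n = {v \<in> carrier_vec n. \<forall>i<n. v $ i \<in> \<int>}"

definition QZ :: "nat \<Rightarrow> rat vec set monoid" where
  "QZ n = monoid_vec TYPE(rat) n Mod int_vecs n"

definition QZ_class :: "nat \<Rightarrow> rat vec \<Rightarrow> rat vec set" where
  "QZ_class n v = int_vecs n #>\<^bsub>monoid_vec TYPE(rat) n\<^esub> v"

definition Gmax :: "int mat \<Rightarrow> rat vec set set" where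
  "Gmax A = {g \<in> carrier (QZ (dim_col A)).
     \<forall>v \<in> g. map_mat rat_of_int A *\<^sub>v v \<in> int_vecs (dim_row A)}"


section \<open>Smith normal form\<close>

definition full_column_rank :: "int mat \<Rightarrow> bool" where
  "full_column_rank A \<longleftrightarrow> vec_space.rank (dim_row A) (map_mat rat_of_int A) = dim_col A"

definition smith_normal_form :: "int mat \<Rightarrow> int mat \<Rightarrow> int mat \<Rightarrow> int mat \<Rightarrow> bool" where
  "smith_normal_form A P Q S \<longleftrightarrow>
     (let m = dim_row A; n = dim_col A in
        P \<in> carrier_mat m m \<and> invertible_mat P \<and>
        Q \<in> carrier_mat n n \<and> invertible_mat Q \<and>
        S = P * A * Q \<and> n \<le> m \<and>
        (\<forall>i<m. \<forall>j<n. i \<noteq> j \<longrightarrow> S $$ (i, j) = 0) \<and>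
        (\<forall>i<n. 0 < S $$ (i, i)) \<and>
        (\<forall>i. Suc i < n \<longrightarrow> S $$ (i, i) dvd S $$ (Suc i, Suc i)))"

definition scaled_columns :: "int mat \<Rightarrow> int mat \<Rightarrow> rat vec list" where
  "scaled_columns S Q =
     map (\<lambda>i. let a = S $$ (i, i); q = map_vec rat_of_int (col Q i)
              in if a \<noteq> 1 then (1 / rat_of_int a) \<cdot>\<^sub>v q else q)
       [0..<dim_col Q]"


section \<open>Bit cost: structured programs for a random access machine\<close>

text \<open>
  The memory has one integer per integer address. Costs follow the logarithmic criterion: an
  operation is charged the bit lengths of all integers it handles, addresses and result included,
  and each multiplication or division is charged \<open>B t\<close> in addition, where \<open>t\<close> is the larger bit
  length of its arguments. This cost is the number of bit operations.
\<close>

type_synonym memory = "int \<Rightarrow> int"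

text \<open>\<open>Cell a\<close> is the cell with address \<open>a\<close>, \<open>Ptr a\<close> the one whose address is stored in cell \<open>a\<close>.\<close>

datatype loc = Cell int | Ptr int

datatype operand = Lit int | Val loc

datatype binop = ADD | SUB | MUL | DIV | MOD

datatype test = LESS operand operand | EQUAL operand operand

datatype com =
    Skip
  | Assign loc binop operand operand
  | Seq com com
  | Cond test com com
  | While test com

text \<open>One bit is for the sign; \<open>bitlen 0 = 0\<close>.\<close>

definition bit_len :: "int \<Rightarrow> nat" where
  "bit_len x = Suc (nat (bitlen \<bar>x\<bar>))"

fun addr :: "memory \<Rightarrow> loc \<Rightarrow> int" where
  "addr s (Cell a) = a"
| "addr s (Ptr a) = s a"

fun addr_cost :: "memory \<Rightarrow> loc \<Rightarrow> nat" where
  "addr_cost s (Cell a) = bit_len a"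
| "addr_cost s (Ptr a) = bit_len a + bit_len (s a)"

fun val :: "memory \<Rightarrow> operand \<Rightarrow> int" where
  "val s (Lit k) = k"
| "val s (Val l) = s (addr s l)"

fun val_cost :: "memory \<Rightarrow> operand \<Rightarrow> nat" where
  "val_cost s (Lit k) = bit_len k"
| "val_cost s (Val l) = addr_cost s l + bit_len (s (addr s l))"

fun binop_val :: "binop \<Rightarrow> int \<Rightarrow> int \<Rightarrow> int" where
  "binop_val ADD x y = x + y"
| "binop_val SUB x y = x - y"
| "binop_val MUL x y = x * y"
| "binop_val DIV x y = x div y"
| "binop_val MOD x y = x mod y"

definition binop_cost :: "(nat \<Rightarrow> nat) \<Rightarrow> binop \<Rightarrow> int \<Rightarrow> int \<Rightarrow> nat" where
  "binop_cost B f x y =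
     bit_len (binop_val f x y) +
     (if f \<in> {MUL, DIV, MOD} then B (nat (max (bitlen \<bar>x\<bar>) (bitlen \<bar>y\<bar>))) else 0)"

fun test_val :: "memory \<Rightarrow> test \<Rightarrow> bool" where
  "test_val s (LESS u v) = (val s u < val s v)"
| "test_val s (EQUAL u v) = (val s u = val s v)"

fun test_cost :: "memory \<Rightarrow> test \<Rightarrow> nat" where
  "test_cost s (LESS u v) = val_cost s u + val_cost s v"
| "test_cost s (EQUAL u v) = val_cost s u + val_cost s v"

text \<open>\<open>exec B c s t s'\<close>: started in \<open>s\<close>, program \<open>c\<close> halts in \<open>s'\<close> at total cost \<open>t\<close>.\<close>

inductive exec :: "(nat \<Rightarrow> nat) \<Rightarrow> com \<Rightarrow> memory \<Rightarrow> nat \<Rightarrow> memory \<Rightarrow> bool"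
  for B :: "nat \<Rightarrow> nat" where
  exec_Skip: "exec B Skip s 1 s"
| exec_Assign:
    "exec B (Assign l f u v) s
       (addr_cost s l + val_cost s u + val_cost s v + binop_cost B f (val s u) (val s v))
       (s(addr s l := binop_val f (val s u) (val s v)))"
| exec_Seq: "exec B c1 s t1 s1 \<Longrightarrow> exec B c2 s1 t2 s2 \<Longrightarrow> exec B (Seq c1 c2) s (t1 + t2) s2"
| exec_Cond_True: "test_val s b \<Longrightarrow> exec B c1 s t s' \<Longrightarrow>
    exec B (Cond b c1 c2) s (test_cost s b + t) s'"
| exec_Cond_False: "\<not> test_val s b \<Longrightarrow> exec B c2 s t s' \<Longrightarrow>
    exec B (Cond b c1 c2) s (test_cost s b + t) s'"
| exec_While_False: "\<not> test_val s b \<Longrightarrow> exec B (While b c) s (test_cost s b) s"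
| exec_While_True: "test_val s b \<Longrightarrow> exec B c s t1 s1 \<Longrightarrow> exec B (While b c) s1 t2 s2 \<Longrightarrow>
    exec B (While b c) s (test_cost s b + t1 + t2) s2"

text \<open>
  Memory layout: cells \<open>0\<close> and \<open>1\<close> hold \<open>m\<close> and \<open>n\<close>; then come, row by row, the \<open>m \<times> n\<close> input
  \<open>A\<close> (later replaced by \<open>S\<close>), the \<open>n \<times> n\<close> matrix \<open>Q\<close>, and an \<open>n \<times> n\<close> matrix of denominators.
  Negative addresses are working registers.
\<close>

definition load_mat :: "int mat \<Rightarrow> memory" where
  "load_mat A = (\<lambda>x.
     let m = dim_row A; n = dim_col A; k = nat (x - 2) in
     if x = 0 then int m
     else if x = 1 then int n
     else if 2 \<le> x \<and> k < m * n then A $$ (k div n, k mod n)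
     else 0)"

definition read_mat :: "memory \<Rightarrow> nat \<Rightarrow> nat \<Rightarrow> nat \<Rightarrow> int mat" where
  "read_mat s b r c = mat r c (\<lambda>(i, j). s (int (b + i * c + j)))"

definition S_base :: nat where
  "S_base = 2"

definition Q_base :: "nat \<Rightarrow> nat \<Rightarrow> nat" where
  "Q_base m n = S_base + m * n"

definition D_base :: "nat \<Rightarrow> nat \<Rightarrow> nat" where
  "D_base m n = Q_base m n + n * n"

text \<open>The transformation \<open>P\<close> is not used afterwards, so it need not be stored.\<close>

definition holds_smith_form :: "int mat \<Rightarrow> int mat \<Rightarrow> int mat \<Rightarrow> memory \<Rightarrow> bool" where
  "holds_smith_form A S Q s \<longleftrightarrow>
     (let m = dim_row A; n = dim_col A in
        s 0 = int m \<and> s 1 = int n \<and>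
        S = read_mat s S_base m n \<and> Q = read_mat s (Q_base m n) n n \<and>
        (\<exists>P. smith_normal_form A P Q S))"

text \<open>The \<open>n\<close> columns of numerators over denominators (fractions need not be reduced).\<close>

definition read_columns :: "memory \<Rightarrow> nat \<Rightarrow> nat \<Rightarrow> rat vec list" where
  "read_columns s m n =
     map (\<lambda>i. vec n (\<lambda>j. rat_of_int (read_mat s (Q_base m n) n n $$ (j, i)) /
                         rat_of_int (read_mat s (D_base m n) n n $$ (j, i))))
       [0..<n]"


section \<open>Running time of the Smith normal form routine\<close>

text \<open>
  \<open>f \<in> O~(g)\<close> in several variables: the bound is uniform over the inputs in \<open>X\<close>. Logarithms are
  replaced by \<open>1\<close> where they are smaller, since a literal \<open>log \<parallel>A\<parallel>\<close> vanishes for \<open>\<parallel>A\<parallel> = 1\<close>.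
\<close>

definition log1 :: "real \<Rightarrow> real" where
  "log1 x = log 2 (max 2 x)"

definition soft_O :: "'a set \<Rightarrow> ('a \<Rightarrow> real) \<Rightarrow> ('a \<Rightarrow> real) set" where
  "soft_O X g = {f. \<exists>C (k::nat). \<forall>x \<in> X. \<bar>f x\<bar> \<le> C * (g x * log1 (g x) ^ k)}"

definition smith_inputs :: "int mat set" where
  "smith_inputs = {A. 0 < dim_col A \<and> full_column_rank A}"

definition storjohann_bound :: "(nat \<Rightarrow> nat) \<Rightarrow> real \<Rightarrow> int mat \<Rightarrow> real" where
  "storjohann_bound B \<theta> A =
     (let m = real (dim_row A); n = real (dim_col A) in
        m powr (\<theta> - 1) * n * real (B (nat \<lceil>m * log1 (real_of_int (mat_norm A))\<rceil>)))"

definition smith_routine :: "(nat \<Rightarrow> nat) \<Rightarrow> real \<Rightarrow> com \<Rightarrow> bool" where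
  "smith_routine B \<theta> c \<longleftrightarrow>
     (\<exists>T :: int mat \<Rightarrow> nat.
        (\<forall>A \<in> smith_inputs. \<exists>s S Q. exec B c (load_mat A) (T A) s \<and> holds_smith_form A S Q s) \<and>
        (\<lambda>A. real (T A)) \<in> soft_O smith_inputs (storjohann_bound B \<theta>))"


section \<open>The algorithm\<close>

abbreviation reg_i :: loc where "reg_i \<equiv> Cell (-1)"
abbreviation reg_j :: loc where "reg_j \<equiv> Cell (-2)"
abbreviation reg_a :: loc where "reg_a \<equiv> Cell (-3)"
abbreviation reg_d :: loc where "reg_d \<equiv> Cell (-4)"
abbreviation reg_p :: loc where "reg_p \<equiv> Cell (-5)"
abbreviation at_p :: loc where "at_p \<equiv> Ptr (-5)"
abbreviation reg_m :: loc where "reg_m \<equiv> Cell 0"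
abbreviation reg_n :: loc where "reg_n \<equiv> Cell 1"

abbreviation copy :: "loc \<Rightarrow> operand \<Rightarrow> com" where
  "copy l u \<equiv> Assign l ADD u (Lit 0)"

fun block :: "com list \<Rightarrow> com" where
  "block [] = Skip"
| "block (c # cs) = Seq c (block cs)"

text \<open>
  The column \<open>i\<close> of \<open>Q\<close> is multiplied by \<open>1/a\<close>, where \<open>a = S\<^bsub>ii\<^esub>\<close>, by turning the denominators of its
  entries from \<open>1\<close> into \<open>a\<close>.
\<close>

definition scale_columns :: com where
  "scale_columns = block [
     \<comment> \<open>\<open>d := D_base m n\<close>\<close>
     Assign reg_d MUL (Val reg_m) (Val reg_n),
     Assign reg_p MUL (Val reg_n) (Val reg_n),
     Assign reg_d ADD (Val reg_d) (Val reg_p),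
     Assign reg_d ADD (Val reg_d) (Lit 2),
     copy reg_i (Lit 0),
     While (LESS (Val reg_i) (Val reg_n)) (block [
       \<comment> \<open>\<open>a := S(i, i)\<close>\<close>
       Assign reg_p MUL (Val reg_i) (Val reg_n),
       Assign reg_p ADD (Val reg_p) (Val reg_i),
       Assign reg_p ADD (Val reg_p) (Lit 2),
       copy reg_a (Val at_p),
       copy reg_j (Lit 0),
       While (LESS (Val reg_j) (Val reg_n)) (block [
         \<comment> \<open>\<open>p\<close> := address of the denominator of \<open>Q(j, i)\<close>\<close>
         Assign reg_p MUL (Val reg_j) (Val reg_n),
         Assign reg_p ADD (Val reg_p) (Val reg_i),
         Assign reg_p ADD (Val reg_p) (Val reg_d),
         copy at_p (Lit 1),
         Cond (EQUAL (Val reg_a) (Lit 1)) Skip (copy at_p (Val reg_a)),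
         Assign reg_j ADD (Val reg_j) (Lit 1)]),
       Assign reg_i ADD (Val reg_i) (Lit 1)])]"

definition gmax_gens :: "com \<Rightarrow> com" where
  "gmax_gens snf = Seq snf scale_columns"

end

theory Submission
  imports Defs
begin

text \<open>
  The input satisfies the precondition of the Smith normal form routine: if the exponent matrix \<open>A\<close> of an
  admissible polynomial had a kernel vector \<open>v\<close>, the weights \<open>q\<close> could be replaced by \<open>q + \<epsilon> v\<close>,
  against their uniqueness. So \<open>A\<close> has full column rank (\<open>admissible_full_column_rank\<close>).

  The output generates \<open>Gmax A\<close>: with \<open>S = P A Q\<close> and \<open>P\<close>, \<open>Q\<close> unimodular, \<open>A v\<close> is integral iff
  \<open>S (Q\<^sup>-\<^sup>1 v)\<close> is. As \<open>S\<close> is diagonal with entries \<open>a\<^sub>i\<close>, this says that \<open>v\<close> is an integer combination of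
  the columns of \<open>Q\<close> divided by the \<open>a\<^sub>i\<close>. The projection \<open>\<rat>\<^sup>n \<rightarrow> (\<rat>/\<int>)\<^sup>n\<close> carries this description of a lattice
  over to the quotient (\<open>Gmax_generated_by_scaled_columns\<close>).

  The routine is polynomial, because \<open>B\<close> is bounded by a polynomial, \<open>log x\<close> by \<open>x\<close>, and \<open>m powr (\<theta> - 1)\<close>
  by a natural power of \<open>m\<close>. The scaling phase performs a number of operations that is quadratic in \<open>n\<close>
  (\<open>runs_scale_columns\<close>), so only the lengths of the integers in these operations matter. Indices and addresses
  are polynomial in \<open>m\<close> and \<open>n\<close>. For the invariant factors, the cost model itself gives the bound: storing an
  integer is charged its bit length, so whatever the routine has stored has at most as many bits
  as the running time of the routine (\<open>exec_bit_len_le_cost\<close>).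
\<close>


section \<open>Exponent matrices have full column rank\<close>

lemma scaled_monomial:
  assumes "c \<noteq> (0::complex)"
  shows "(\<Prod>j\<in>K. (c powr of_rat (q j) * x j) ^ e j) =
         c powr of_rat (\<Sum>j\<in>K. of_nat (e j) * q j) * (\<Prod>j\<in>K. x j ^ e j)"
proof (induction K rule: infinite_finite_induct)
  case (insert j K)
  have "(c powr of_rat (q j)) ^ e j = c powr of_rat (of_nat (e j) * q j)"
    using assms by (simp add: powr_def of_rat_mult mult.assoc flip: exp_of_nat_mult)
  then show ?case
    using insert assms by (simp add: power_mult_distrib of_rat_add powr_add mult_ac)
qed (use assms in auto)

text \<open>
  A monomial \<open>a\<close> picks up the factor \<open>c powr (\<Sum>j<n. a j * q j)\<close> under the scaling by \<open>c\<close>. So being a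
  system of weights depends, besides positivity, only on the weighted degrees of the monomials.
\<close>

lemma is_weights_transfer:
  assumes W: "in_vars n W" and q: "is_weights n W q" and pos: "\<And>j. j < n \<Longrightarrow> 0 < q' j"
    and eq: "\<And>a. a \<in> Poly_Mapping.keys W \<Longrightarrow>
      (\<Sum>j<n. of_nat (Poly_Mapping.lookup a j) * q' j) = (\<Sum>j<n. of_nat (Poly_Mapping.lookup a j) * q j)"
  shows "is_weights n W q'"
proof -
  have "peval W (\<lambda>j. c powr of_rat (q' j) * x j) = peval W (\<lambda>j. c powr of_rat (q j) * x j)" for c x
  proof (cases "c = 0")
    case False
    have "(\<Prod>j\<in>Poly_Mapping.keys a. (c powr of_rat (q' j) * x j) ^ Poly_Mapping.lookup a j) =
          (\<Prod>j\<in>Poly_Mapping.keys a. (c powr of_rat (q j) * x j) ^ Poly_Mapping.lookup a j)"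
      if a: "a \<in> Poly_Mapping.keys W" for a
    proof -
      have sub: "Poly_Mapping.keys a \<subseteq> {..<n}"
        using W a by (auto simp: in_vars_def)
      have "(\<Sum>j\<in>Poly_Mapping.keys a. of_nat (Poly_Mapping.lookup a j) * r j) =
            (\<Sum>j<n. of_nat (Poly_Mapping.lookup a j) * r j)" for r :: "nat \<Rightarrow> rat"
        by (rule sum.mono_neutral_left) (use sub in \<open>auto simp: in_keys_iff\<close>)
      then show ?thesis
        using eq[OF a] False by (simp add: scaled_monomial)
    qed
    then show ?thesis
      by (simp add: peval_def)
  qed simp
  then show ?thesis
    using q pos by (simp add: is_weights_def)
qed

text \<open>
  Positivity of finitely many weights is an open condition: weights can be moved a little in any
  direction.
\<close>

lemma positive_shift:
  fixes q v :: "nat \<Rightarrow> rat"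
  assumes "\<And>j. j < n \<Longrightarrow> 0 < q j"
  shows "\<exists>\<epsilon>>0. \<forall>j<n. 0 < q j + \<epsilon> * v j"
  using assms
proof (induction n)
  case 0
  show ?case by (rule exI[of _ 1]) auto
next
  case (Suc n)
  then obtain \<epsilon> where e: "\<epsilon> > 0" "\<forall>j<n. 0 < q j + \<epsilon> * v j"
    by force
  \<comment> \<open>The second bound gives \<open>\<delta> * \<bar>v n\<bar> < q n\<close>; the summand \<open>1\<close> avoids a division by \<open>0\<close>.\<close>
  define \<delta> where "\<delta> = min \<epsilon> (q n / (2 * (\<bar>v n\<bar> + 1)))"
  have qn: "q n > 0" using Suc.prems by simp
  have d: "\<delta> > 0" "\<delta> \<le> \<epsilon>" using qn e by (auto simp: \<delta>_def)
  have "0 < q j + \<delta> * v j" if "j < n" for j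
  proof (cases "v j \<ge> 0")
    case True
    then show ?thesis using Suc.prems[of j] that d by (simp add: add_pos_nonneg)
  next
    case False
    then have "\<delta> * v j \<ge> \<epsilon> * v j" using d by (simp add: mult_right_mono_neg)
    then show ?thesis using e that by force
  qed
  moreover have "0 < q n + \<delta> * v n"
  proof -
    have "\<delta> * \<bar>v n\<bar> \<le> q n / (2 * (\<bar>v n\<bar> + 1)) * \<bar>v n\<bar>"
      by (rule mult_right_mono) (auto simp: \<delta>_def)
    also have "\<dots> < q n"
    proof -
      have "0 < q n * (\<bar>v n\<bar> + 2)" using qn by (intro mult_pos_pos) auto
      then show ?thesis by (simp add: field_simps)
    qed
    finally have "\<bar>\<delta> * v n\<bar> < q n"
      using d by (simp add: abs_mult)
    then show ?thesis by linarith
  qed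
  ultimately show ?case using d(1) less_Suc_eq by metis
qed

text \<open>
  The rank counts the independent elements of the set of columns. Two equal columns therefore need a
  separate kernel vector, the difference of the corresponding unit vectors.
\<close>

lemma rank_deficient_kernel_vector:
  fixes A :: "rat mat"
  assumes A: "A \<in> carrier_mat m n" and rank: "vec_space.rank m A \<noteq> n"
  obtains v where "v \<in> carrier_vec n" "v \<noteq> 0\<^sub>v n" "A *\<^sub>v v = 0\<^sub>v m"
proof (cases "distinct (cols A)")
  case True
  then have "module.lin_dep class_ring (module_vec TYPE(rat) m) (set (cols A))"
    using vec_space.lin_indpt_full_rank[OF A] rank by blast
  then show ?thesis
    using vec_space.lin_depE[OF A _ True] that by blast
next
  case False
  then obtain i j where ij: "i < n" "j < n" "i \<noteq> j" "col A i = col A j"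
    using A by (auto simp: distinct_conv_nth)
  let ?v = "unit_vec n i - unit_vec n j :: rat vec"
  have "?v $ i \<noteq> 0\<^sub>v n $ i" using ij by simp
  then have "?v \<noteq> 0\<^sub>v n" by metis
  moreover have "A *\<^sub>v ?v = 0\<^sub>v m"
  proof (rule eq_vecI)
    fix k assume k: "k < dim_vec (0\<^sub>v m :: rat vec)"
    then have "scalar_prod (row A k) ?v = scalar_prod (row A k) (unit_vec n i) - scalar_prod (row A k) (unit_vec n j)"
      using A by (intro scalar_prod_minus_distrib[of _ n]) auto
    moreover have "A $$ (k, i) = A $$ (k, j)"
      using ij A k by (metis carrier_matD index_col index_zero_vec(2))
    ultimately show "(A *\<^sub>v ?v) $ k = 0\<^sub>v m $ k"
      using A ij k by simp
  qed (use A in simp)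
  ultimately show ?thesis using that[of ?v] by simp
qed

text \<open>
  A kernel vector \<open>v\<close> of the exponent matrix changes no weighted degree, so \<open>q + \<epsilon> v\<close> is a second system
  of weights for every small \<open>\<epsilon> > 0\<close>. This contradicts uniqueness.
\<close>

lemma admissible_full_column_rank:
  assumes W: "admissible n W" and A: "exponent_matrix n W A"
  shows "full_column_rank A"
proof (rule ccontr)
  assume deficient: "\<not> full_column_rank A"
  obtain ms where ms: "distinct ms" "set ms = Poly_Mapping.keys W"
    and A_eq: "A = mat (length ms) n (\<lambda>(i, j). int (Poly_Mapping.lookup (ms ! i) j))"
    using A by (auto simp: exponent_matrix_def)
  have dims: "map_mat rat_of_int A \<in> carrier_mat (length ms) n"
    by (simp add: A_eq)
  obtain v where v: "v \<in> carrier_vec n" "v \<noteq> 0\<^sub>v n" and ker: "map_mat rat_of_int A *\<^sub>v v = 0\<^sub>v (length ms)"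
    using rank_deficient_kernel_vector[OF dims] deficient by (auto simp: full_column_rank_def A_eq)
  obtain q where q: "is_weights n W q"
    using W by (auto simp: admissible_def)
  obtain \<epsilon> where \<epsilon>: "\<epsilon> > 0" "\<forall>j<n. 0 < q j + \<epsilon> * v $ j"
    using positive_shift[of n q "\<lambda>j. v $ j"] q by (auto simp: is_weights_def)
  define q' where "q' = (\<lambda>j. q j + \<epsilon> * v $ j)"
  have "(\<Sum>j<n. of_nat (Poly_Mapping.lookup a j) * q' j) = (\<Sum>j<n. of_nat (Poly_Mapping.lookup a j) * q j)"
    if a: "a \<in> Poly_Mapping.keys W" for a
  proof -
    obtain i where i: "i < length ms" "a = ms ! i"
      using a ms by (metis in_set_conv_nth)
    have "(map_mat rat_of_int A *\<^sub>v v) $ i = (\<Sum>j<n. of_nat (Poly_Mapping.lookup a j) * v $ j)"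
      using i v(1) by (simp add: A_eq scalar_prod_def lessThan_atLeast0)
    then have "(\<Sum>j<n. of_nat (Poly_Mapping.lookup a j) * v $ j) = 0"
      using ker i by simp
    moreover have "(\<Sum>j<n. of_nat (Poly_Mapping.lookup a j) * q' j) =
        (\<Sum>j<n. of_nat (Poly_Mapping.lookup a j) * q j) + \<epsilon> * (\<Sum>j<n. of_nat (Poly_Mapping.lookup a j) * v $ j)"
      by (simp add: q'_def algebra_simps sum.distrib sum_distrib_left)
    ultimately show ?thesis by simp
  qed
  then have "is_weights n W q'"
    using is_weights_transfer[of n W q q'] W q \<epsilon>(2) unfolding admissible_def q'_def by blast
  then have "\<forall>j<n. q' j = q j"
    using W q unfolding admissible_def by blast
  then have "\<forall>j<n. v $ j = 0"
    using \<epsilon>(1) by (simp add: q'_def)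
  then show False
    using v by auto
qed

section \<open>Generators of the maximal symmetry group\<close>

lemma int_vecs_subgroup: "subgroup (int_vecs n) (monoid_vec TYPE(rat) n)"
proof -
  interpret comm_group "monoid_vec TYPE(rat) n" by (rule comm_group_vec)
  show ?thesis
  proof (rule subgroupI)
    show "int_vecs n \<subseteq> carrier (monoid_vec TYPE(rat) n)"
      by (auto simp: int_vecs_def monoid_vec_simps)
    have "0\<^sub>v n \<in> int_vecs n" by (auto simp: int_vecs_def)
    then show "int_vecs n \<noteq> {}" by blast
  next
    fix v assume v: "v \<in> int_vecs n"
    then have "inv\<^bsub>monoid_vec TYPE(rat) n\<^esub> v = - v"
      by (intro inv_equality) (auto simp: int_vecs_def monoid_vec_simps)
    then show "inv\<^bsub>monoid_vec TYPE(rat) n\<^esub> v \<in> int_vecs n"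
      using v by (auto simp: int_vecs_def)
  qed (auto simp: int_vecs_def monoid_vec_simps)
qed

text \<open>
  Generation is transported along this projection, so that the generators can be found
  in \<open>\<rat>\<^sup>n\<close>, where vectors have coordinates.
\<close>

lemma QZ_class_hom: "group_hom (monoid_vec TYPE(rat) n) (QZ n) (QZ_class n)"
proof -
  interpret comm_group "monoid_vec TYPE(rat) n" by (rule comm_group_vec)
  interpret normal "int_vecs n" "monoid_vec TYPE(rat) n"
    using int_vecs_subgroup by (simp add: normal_iff_subgroup)
  show ?thesis
    using r_coset_hom_Mod factorgroup_is_group
    by (simp add: group_hom_def group_hom_axioms_def QZ_def QZ_class_def[abs_def])
qed

lemma int_mat_mult_int_vecs:
  assumes "M \<in> carrier_mat r n" "v \<in> int_vecs n"
  shows "map_mat rat_of_int M *\<^sub>v v \<in> int_vecs r"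
  using assms by (auto simp: int_vecs_def scalar_prod_def intro!: Ints_sum Ints_mult)

text \<open>
  The preimage of \<open>Gmax A\<close> under the projection \<open>\<rat>\<^sup>n \<rightarrow> (\<rat>/\<int>)\<^sup>n\<close>.
\<close>

definition integral_preimage :: "int mat \<Rightarrow> rat vec set" where
  "integral_preimage A =
     {v \<in> carrier_vec (dim_col A). map_mat rat_of_int A *\<^sub>v v \<in> int_vecs (dim_row A)}"

text \<open>
  Integrality of \<open>A v\<close> depends only on the class of \<open>v\<close> modulo \<open>\<int>\<^sup>n\<close>, because \<open>A\<close> has integer entries.
\<close>

lemma Gmax_eq_image: "Gmax A = QZ_class (dim_col A) ` integral_preimage A"
proof -
  let ?n = "dim_col A" and ?A = "map_mat rat_of_int A"
  have A: "?A \<in> carrier_mat (dim_row A) ?n" by simp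
  have "(\<forall>w \<in> QZ_class ?n v. ?A *\<^sub>v w \<in> int_vecs (dim_row A)) \<longleftrightarrow>
        ?A *\<^sub>v v \<in> int_vecs (dim_row A)" (is "?L \<longleftrightarrow> ?R") if v: "v \<in> carrier_vec ?n" for v
  proof
    assume ?L
    moreover have "0\<^sub>v ?n + v \<in> QZ_class ?n v"
      unfolding QZ_class_def r_coset_def monoid_vec_simps
      by (rule UN_I[of "0\<^sub>v ?n"]) (auto simp: int_vecs_def)
    ultimately show ?R using v by auto
  next
    assume R: ?R
    have "?A *\<^sub>v (h + v) \<in> int_vecs (dim_row A)" if h: "h \<in> int_vecs ?n" for h
    proof -
      have "?A *\<^sub>v (h + v) = ?A *\<^sub>v h + ?A *\<^sub>v v"
        by (rule mult_add_distrib_mat_vec[OF A]) (use h v in \<open>auto simp: int_vecs_def\<close>)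
      moreover have "?A *\<^sub>v h \<in> int_vecs (dim_row A)"
        by (rule int_mat_mult_int_vecs) (use h in auto)
      ultimately show ?thesis
        using R by (auto simp: int_vecs_def)
    qed
    then show ?L
      by (auto simp: QZ_class_def r_coset_def monoid_vec_simps)
  qed
  moreover have "carrier (QZ ?n) = QZ_class ?n ` carrier_vec ?n"
    by (auto simp: QZ_def FactGroup_def RCOSETS_def QZ_class_def monoid_vec_simps)
  ultimately show ?thesis
    by (auto simp: Gmax_def integral_preimage_def)
qed

lemma integral_preimage_subgroup:
  "subgroup (integral_preimage A) (monoid_vec TYPE(rat) (dim_col A))"
proof -
  let ?n = "dim_col A" and ?A = "map_mat rat_of_int A"
  interpret comm_group "monoid_vec TYPE(rat) ?n" by (rule comm_group_vec)
  show ?thesis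
  proof (rule subgroupI)
    show "integral_preimage A \<subseteq> carrier (monoid_vec TYPE(rat) ?n)"
      by (auto simp: integral_preimage_def monoid_vec_simps)
    have "0\<^sub>v ?n \<in> integral_preimage A"
      using int_mat_mult_int_vecs[of A "dim_row A" ?n "0\<^sub>v ?n"]
      by (simp add: integral_preimage_def int_vecs_def)
    then show "integral_preimage A \<noteq> {}" by blast
  next
    fix v assume v: "v \<in> integral_preimage A"
    then have "inv\<^bsub>monoid_vec TYPE(rat) ?n\<^esub> v = - v"
      by (intro inv_equality) (auto simp: integral_preimage_def monoid_vec_simps)
    moreover have "?A *\<^sub>v (- v) = - (?A *\<^sub>v v)"
      using v by (intro eq_vecI) (auto simp: integral_preimage_def)
    ultimately show "inv\<^bsub>monoid_vec TYPE(rat) ?n\<^esub> v \<in> integral_preimage A"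
      using v by (auto simp: integral_preimage_def int_vecs_def)
  next
    fix v w assume vw: "v \<in> integral_preimage A" "w \<in> integral_preimage A"
    then have "?A *\<^sub>v (v + w) = ?A *\<^sub>v v + ?A *\<^sub>v w"
      by (intro mult_add_distrib_mat_vec[of _ "dim_row A" ?n]) (auto simp: integral_preimage_def)
    then show "v \<otimes>\<^bsub>monoid_vec TYPE(rat) ?n\<^esub> w \<in> integral_preimage A"
      using vw subgroup.m_closed[OF int_vecs_subgroup, of "?A *\<^sub>v v" "dim_row A" "?A *\<^sub>v w"]
      by (simp add: integral_preimage_def monoid_vec_simps)
  qed
qed

text \<open>
  Subgroups of \<open>\<rat>\<^sup>n\<close> are \<open>\<int>\<close>-modules. This turns coefficients into membership in a generated subgroup.
\<close>

lemma int_combination_in_subgroup: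
  fixes z :: "nat \<Rightarrow> int"
  assumes H: "subgroup H (monoid_vec TYPE(rat) n)" and w: "\<And>i. i < k \<Longrightarrow> w i \<in> H"
  shows "vec n (\<lambda>j. \<Sum>i<k. of_int (z i) * w i $ j) \<in> H"
proof -
  interpret comm_group "monoid_vec TYPE(rat) n" by (rule comm_group_vec)
  have carrier: "v \<in> carrier_vec n" if "v \<in> H" for v
    using subgroup.mem_carrier[OF H that] by (simp add: monoid_vec_simps)
  have zero: "0\<^sub>v n \<in> H" and add: "\<And>u v. u \<in> H \<Longrightarrow> v \<in> H \<Longrightarrow> u + v \<in> H"
    using subgroup.one_closed[OF H] subgroup.m_closed[OF H] by (simp_all add: monoid_vec_simps)
  have uminus: "- v \<in> H" if "v \<in> H" for v
  proof -
    have "inv\<^bsub>monoid_vec TYPE(rat) n\<^esub> v = - v"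
      by (rule inv_equality) (use carrier[OF that] in \<open>auto simp: monoid_vec_simps\<close>)
    then show ?thesis using subgroup.m_inv_closed[OF H that] by simp
  qed
  have nat: "of_nat l \<cdot>\<^sub>v v \<in> H" if v: "v \<in> H" for l v
  proof (induction l)
    case 0
    have "(0::rat) \<cdot>\<^sub>v v = 0\<^sub>v n" using carrier[OF v] by auto
    then show ?case using zero by simp
  next
    case (Suc l)
    have "of_nat (Suc l) \<cdot>\<^sub>v v = v + of_nat l \<cdot>\<^sub>v v"
      using carrier[OF v] by (auto simp: algebra_simps)
    then show ?case using add[OF v Suc] by simp
  qed
  have int: "of_int y \<cdot>\<^sub>v v \<in> H" if v: "v \<in> H" for y v
  proof (cases "y \<ge> 0")
    case True
    then show ?thesis using nat[OF v, of "nat y"] by simp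
  next
    case False
    then have "of_int y \<cdot>\<^sub>v v = - (of_nat (nat (- y)) \<cdot>\<^sub>v v)"
      by (intro eq_vecI) auto
    then show ?thesis using uminus[OF nat[OF v]] by simp
  qed
  show ?thesis
    using w
  proof (induction k)
    case 0
    have "vec n (\<lambda>j. \<Sum>i<0. of_int (z i) * w i $ j) = 0\<^sub>v n" by auto
    then show ?case using zero by simp
  next
    case (Suc k)
    have "vec n (\<lambda>j. \<Sum>i<Suc k. of_int (z i) * w i $ j) =
          vec n (\<lambda>j. \<Sum>i<k. of_int (z i) * w i $ j) + of_int (z k) \<cdot>\<^sub>v w k"
      using carrier[OF Suc.prems[of k]] by (intro eq_vecI) auto
    moreover have "vec n (\<lambda>j. \<Sum>i<k. of_int (z i) * w i $ j) \<in> H"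
      using Suc by simp
    ultimately show ?case
      using add int[OF Suc.prems[of k]] by simp
  qed
qed

lemma invertible_int_mat_inverse:
  assumes "invertible_mat P" "P \<in> carrier_mat n n"
  obtains P' :: "int mat" where "P' \<in> carrier_mat n n" "P * P' = 1\<^sub>m n" "P' * P = 1\<^sub>m n"
proof -
  obtain P' where inv: "P * P' = 1\<^sub>m n" "P' * P = 1\<^sub>m (dim_row P')"
    using assms by (auto simp: invertible_mat_def inverts_mat_def)
  have "dim_col P' = n" using arg_cong[OF inv(1), of dim_col] by simp
  moreover have "dim_row P' = n" using arg_cong[OF inv(2), of dim_col] assms by simp
  ultimately show ?thesis using that[of P'] inv by auto
qed

lemma int_mat_inverse_cancel:
  assumes "M' \<in> carrier_mat n n" "M \<in> carrier_mat n n" "M' * M = 1\<^sub>m n" "y \<in> carrier_vec n"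
  shows "map_mat rat_of_int M' *\<^sub>v (map_mat rat_of_int M *\<^sub>v y) = y"
proof -
  have "map_mat rat_of_int M' * map_mat rat_of_int M = 1\<^sub>m n"
    using of_int_hom.mat_hom_mult[OF assms(1,2)] assms(3) by (metis of_int_hom.mat_hom_one)
  then show ?thesis
    using assoc_mult_mat_vec[of "map_mat rat_of_int M'" n n "map_mat rat_of_int M" n y] assms by simp
qed

text \<open>
  Dividing by \<open>1\<close> changes nothing, so the case distinction in the algorithm can be dropped.
\<close>

lemma scaled_columns_eq:
  "scaled_columns S Q =
     map (\<lambda>i. (1 / rat_of_int (S $$ (i, i))) \<cdot>\<^sub>v map_vec rat_of_int (col Q i)) [0..<dim_col Q]"
  by (auto simp: scaled_columns_def Let_def)

text \<open>
  In the coordinates \<open>h = Q\<^sup>-\<^sup>1 v\<close> the condition becomes diagonal: as \<open>S h = P (A v)\<close> and \<open>P\<close> is unimodular,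
  \<open>A v\<close> is integral iff \<open>S h\<close> is, that is, iff every \<open>a\<^sub>i h\<^sub>i\<close> is an integer \<open>z\<^sub>i\<close>. Then \<open>v = Q h\<close> is the
  combination of the vectors \<open>Q e\<^sub>i / a\<^sub>i\<close> with the integer coefficients \<open>z\<^sub>i\<close>.
\<close>

lemma generate_scaled_columns:
  assumes snf: "smith_normal_form A P Q S"
  shows "generate (monoid_vec TYPE(rat) (dim_col A)) (set (scaled_columns S Q)) = integral_preimage A"
proof -
  define m n where "m = dim_row A" and "n = dim_col A"
  define w where "w i = (1 / rat_of_int (S $$ (i, i))) \<cdot>\<^sub>v map_vec rat_of_int (col Q i)" for i
  let ?h = "map_mat rat_of_int"
  have P: "P \<in> carrier_mat m m" "invertible_mat P" and Q: "Q \<in> carrier_mat n n" "invertible_mat Q"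
    and S: "S = P * A * Q" and nm: "n \<le> m"
    and diag: "\<And>i j. i < m \<Longrightarrow> j < n \<Longrightarrow> i \<noteq> j \<Longrightarrow> S $$ (i, j) = 0"
    and pos: "\<And>i. i < n \<Longrightarrow> 0 < S $$ (i, i)"
    using snf by (auto simp: smith_normal_form_def Let_def m_def n_def)
  have A: "A \<in> carrier_mat m n" by (simp add: m_def n_def)
  have Sc: "S \<in> carrier_mat m n" using P Q A by (simp add: S)
  obtain P' where P': "P' \<in> carrier_mat m m" "P * P' = 1\<^sub>m m" "P' * P = 1\<^sub>m m"
    using invertible_int_mat_inverse P by blast
  obtain Q' where Q': "Q' \<in> carrier_mat n n" "Q * Q' = 1\<^sub>m n" "Q' * Q = 1\<^sub>m n"
    using invertible_int_mat_inverse Q by blast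
  interpret comm_group "monoid_vec TYPE(rat) n" by (rule comm_group_vec)
  have gens: "set (scaled_columns S Q) = w ` {..<n}"
    using Q by (auto simp: scaled_columns_eq w_def[abs_def])
  have wc: "w i \<in> carrier_vec n" for i
    using Q by (auto simp: w_def)
  have mult: "?h S *\<^sub>v u = ?h P *\<^sub>v (?h A *\<^sub>v (?h Q *\<^sub>v u))" if u: "u \<in> carrier_vec n" for u
  proof -
    have "?h S = ?h P * ?h A * ?h Q"
      using P A Q by (simp add: S of_int_hom.mat_hom_mult[of _ m m _ n] of_int_hom.mat_hom_mult[of _ m n _ n])
    then show ?thesis
      using P A Q u by (simp add: assoc_mult_mat_vec[of _ m m _ n] assoc_mult_mat_vec[of _ m n _ n])
  qed
  have S_index: "(?h S *\<^sub>v u) $ i = (if i < n then of_int (S $$ (i, i)) * u $ i else 0)"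
    if u: "u \<in> carrier_vec n" and i: "i < m" for u i
  proof -
    have "(?h S *\<^sub>v u) $ i = (\<Sum>j<n. of_int (S $$ (i, j)) * u $ j)"
      using Sc u i by (simp add: scalar_prod_def lessThan_atLeast0)
    also have "\<dots> = (\<Sum>j<n. if j = i then of_int (S $$ (i, i)) * u $ i else 0)"
      using diag[OF i] by (intro sum.cong) auto
    finally show ?thesis by simp
  qed
  have w_in: "w i \<in> integral_preimage A" if i: "i < n" for i
  proof -
    \<comment> \<open>\<open>u\<close> is the coordinate vector of \<open>w i\<close> with respect to the columns of \<open>Q\<close>, and \<open>S u = e\<^sub>i\<close>.\<close>
    define u where "u = (1 / rat_of_int (S $$ (i, i))) \<cdot>\<^sub>v unit_vec n i"
    have u: "u \<in> carrier_vec n" by (simp add: u_def)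
    have Qu: "?h Q *\<^sub>v u = w i"
    proof (rule eq_vecI)
      fix j assume "j < dim_vec (w i)"
      then have j: "j < n" using wc[of i] by simp
      have "(?h Q *\<^sub>v u) $ j = (\<Sum>l<n. of_int (Q $$ (j, l)) * u $ l)"
        using Q j by (simp add: scalar_prod_def lessThan_atLeast0 u_def)
      also have "\<dots> = (\<Sum>l<n. if l = i then of_int (Q $$ (j, i)) / of_int (S $$ (i, i)) else 0)"
        using i by (intro sum.cong) (auto simp: u_def)
      finally show "(?h Q *\<^sub>v u) $ j = w i $ j"
        using Q i j by (simp add: w_def)
    qed (use Q wc[of i] in simp)
    have "rat_of_int (S $$ (l, i)) / rat_of_int (S $$ (i, i)) \<in> \<int>" if "l < m" for l
      using diag[OF that i] pos[OF i] by (cases "l = i") auto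
    then have "?h S *\<^sub>v u \<in> int_vecs m"
      using Sc i by (auto simp: int_vecs_def u_def)
    then have "?h P' *\<^sub>v (?h S *\<^sub>v u) \<in> int_vecs m"
      by (rule int_mat_mult_int_vecs[OF P'(1)])
    moreover have "?h P' *\<^sub>v (?h S *\<^sub>v u) = ?h A *\<^sub>v w i"
      unfolding mult[OF u] Qu using A wc[of i] by (intro int_mat_inverse_cancel[OF P'(1) P(1) P'(3)]) auto
    ultimately show ?thesis
      using wc[of i] by (simp add: integral_preimage_def flip: m_def n_def)
  qed
  have "integral_preimage A \<subseteq> generate (monoid_vec TYPE(rat) n) (w ` {..<n})"
  proof
    fix v assume v: "v \<in> integral_preimage A"
    then have vc: "v \<in> carrier_vec n" by (simp add: integral_preimage_def n_def)
    define h where "h = ?h Q' *\<^sub>v v"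
    have hc: "h \<in> carrier_vec n" using Q'(1) vc unfolding h_def by (intro mult_mat_vec_carrier[of _ n n]) auto
    have Qh: "?h Q *\<^sub>v h = v"
      unfolding h_def by (rule int_mat_inverse_cancel[OF Q(1) Q'(1,2) vc])
    have Sh: "?h S *\<^sub>v h \<in> int_vecs m"
      unfolding mult[OF hc] Qh
      by (rule int_mat_mult_int_vecs[OF P(1)]) (use v in \<open>simp add: integral_preimage_def m_def\<close>)
    have "of_int (S $$ (i, i)) * h $ i \<in> \<int>" if "i < n" for i
    proof -
      have "(?h S *\<^sub>v h) $ i \<in> \<int>"
        using Sh nm that unfolding int_vecs_def by force
      then show ?thesis
        using S_index[OF hc, of i] nm that by simp
    qed
    then have "\<forall>i<n. \<exists>z. of_int (S $$ (i, i)) * h $ i = of_int z"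
      by (meson Ints_cases)
    then obtain z where z: "\<And>i. i < n \<Longrightarrow> of_int (S $$ (i, i)) * h $ i = of_int (z i)"
      by metis
    have "v = vec n (\<lambda>j. \<Sum>i<n. of_int (z i) * w i $ j)"
    proof (rule eq_vecI)
      fix j assume "j < dim_vec (vec n (\<lambda>j. \<Sum>i<n. of_int (z i) * w i $ j))"
      then have j: "j < n" by simp
      have "v $ j = (\<Sum>i<n. of_int (Q $$ (j, i)) * h $ i)"
        unfolding Qh[symmetric] using Q hc j by (simp add: scalar_prod_def lessThan_atLeast0)
      also have "\<dots> = (\<Sum>i<n. of_int (z i) * w i $ j)"
      proof (rule sum.cong)
        fix i assume "i \<in> {..<n}"
        then show "of_int (Q $$ (j, i)) * h $ i = of_int (z i) * w i $ j"
          using z[of i, symmetric] pos[of i] Q j by (simp add: w_def)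
      qed simp
      finally show "v $ j = vec n (\<lambda>j. \<Sum>i<n. of_int (z i) * w i $ j) $ j"
        using j by simp
    qed (use vc in simp)
    moreover have "subgroup (generate (monoid_vec TYPE(rat) n) (w ` {..<n})) (monoid_vec TYPE(rat) n)"
      using wc by (intro generate_is_subgroup) (auto simp: monoid_vec_simps)
    ultimately show "v \<in> generate (monoid_vec TYPE(rat) n) (w ` {..<n})"
      using int_combination_in_subgroup by (simp add: generate.incl)
  qed
  moreover have "generate (monoid_vec TYPE(rat) n) (w ` {..<n}) \<subseteq> integral_preimage A"
    using integral_preimage_subgroup[of A] w_in
    by (intro generate_subgroup_incl) (auto simp: n_def)
  ultimately show ?thesis
    using gens by (simp add: n_def)
qed

lemma Gmax_generated_by_scaled_columns:
  assumes snf: "smith_normal_form A P Q S"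
  shows "generate (QZ (dim_col A)) (QZ_class (dim_col A) ` set (scaled_columns S Q)) = Gmax A"
proof -
  let ?n = "dim_col A"
  have "set (scaled_columns S Q) \<subseteq> carrier (monoid_vec TYPE(rat) ?n)"
    using snf by (auto simp: scaled_columns_eq smith_normal_form_def Let_def monoid_vec_simps)
  then show ?thesis
    by (simp add: group_hom.generate_img[OF QZ_class_hom] generate_scaled_columns[OF snf] Gmax_eq_image)
qed

section \<open>Running time of structured programs\<close>

lemma bit_len_le: "bit_len x \<le> Suc (nat \<bar>x\<bar>)"
proof -
  have "\<bar>x\<bar> < 2 ^ nat \<bar>x\<bar>"
    by (metis abs_ge_zero less_exp nat_0_le of_nat_less_iff of_nat_numeral of_nat_power)
  then show ?thesis
    by (simp add: bit_len_def bitlen_le_iff_power nat_le_eq_zle nat_le_iff)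
qed

lemma bitlen_le: "nat (bitlen \<bar>x\<bar>) \<le> nat \<bar>x\<bar>"
  using bit_len_le[of x] by (simp add: bit_len_def)

text \<open>
  Every assignment is charged the bit length of the value that it stores. Hence the running time of a
  program bounds the size of everything it has written, in particular that of the invariant factors
  left behind by the Smith normal form routine.
\<close>

lemma exec_bit_len_le_cost:
  "exec B c s t s' \<Longrightarrow> s' x = s x \<or> bit_len (s' x) \<le> t"
proof (induction rule: exec.induct)
  case (exec_Assign l f u v s)
  then show ?case by (simp add: binop_cost_def)
next
  case (exec_Seq c1 s t1 s1 c2 t2 s2)
  then show ?case by (metis trans_le_add1 trans_le_add2)
next
  case (exec_While_True b s c t1 s1 t2 s2)
  then show ?case by (metis trans_le_add1 trans_le_add2)
qed (auto intro: trans_le_add2)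

text \<open>
  Exact costs are replaced by multiples of one unit \<open>U\<close>. It is large enough to pay for handling any
  integer of absolute value at most \<open>X\<close> and for multiplying two of them; later \<open>X\<close> bounds all
  indices and addresses. Matrix entries may exceed \<open>X\<close>: they need only have at most \<open>U\<close> bits, as they
  are copied and compared but never multiplied.
\<close>

locale cost_unit =
  fixes B :: "nat \<Rightarrow> nat" and X U :: nat
  assumes B_le: "b \<le> X \<Longrightarrow> B b \<le> U"
    and bit_len_le_U: "\<bar>x\<bar> \<le> int X \<Longrightarrow> bit_len x \<le> U"
begin

abbreviation fits :: "int \<Rightarrow> bool" where
  "fits x \<equiv> bit_len x \<le> U"

fun loc_fits :: "memory \<Rightarrow> loc \<Rightarrow> bool" where
  "loc_fits s (Cell a) \<longleftrightarrow> fits a"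
| "loc_fits s (Ptr a) \<longleftrightarrow> fits a \<and> fits (s a)"

fun operand_fits :: "memory \<Rightarrow> operand \<Rightarrow> bool" where
  "operand_fits s (Lit k) \<longleftrightarrow> fits k"
| "operand_fits s (Val l) \<longleftrightarrow> loc_fits s l \<and> fits (s (addr s l))"

text \<open>
  Total correctness from the start state \<open>s\<close> within \<open>k\<close> units of cost. The rules for
  sequences below take the rest of the program as a premise on the updated state. Applied as introduction
  rules, they execute straight-line code symbolically and add up its cost.
\<close>

definition runs :: "com \<Rightarrow> memory \<Rightarrow> nat \<Rightarrow> (memory \<Rightarrow> bool) \<Rightarrow> bool" where
  "runs c s k R \<longleftrightarrow> (\<exists>t s'. exec B c s t s' \<and> t \<le> k * U \<and> R s')"

lemma U_pos: "1 \<le> U"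
  using bit_len_le_U[of 0] by (simp add: bit_len_def)

lemma addr_cost_le: "loc_fits s l \<Longrightarrow> addr_cost s l \<le> 2 * U"
  by (cases l) auto

lemma val_cost_le: "operand_fits s u \<Longrightarrow> val_cost s u \<le> 3 * U"
  using addr_cost_le by (cases u) fastforce+

lemma runs_mono: "runs c s k R \<Longrightarrow> k \<le> k' \<Longrightarrow> (\<And>s'. R s' \<Longrightarrow> R' s') \<Longrightarrow> runs c s k' R'"
  unfolding runs_def by (meson le_trans mult_le_mono1)

lemma runs_Skip: "R s \<Longrightarrow> runs Skip s 1 R"
  unfolding runs_def using exec_Skip U_pos by fastforce

lemma runs_Seq: "runs c1 s k1 (\<lambda>s1. runs c2 s1 k2 R) \<Longrightarrow> runs (Seq c1 c2) s (k1 + k2) R"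
  unfolding runs_def by (metis add_mono distrib_right exec_Seq)

text \<open>
  The cost of \<open>Skip\<close> is rounded up to that of an assignment, so that both branches of a conditional
  get the same number of units.
\<close>

lemma runs_Skip_then: "runs c s k R \<Longrightarrow> runs (Seq Skip c) s (10 + k) R"
  by (rule runs_mono[OF runs_Seq[OF runs_Skip]]) auto

text \<open>
  The ten units are two for the target address, three for each operand (cell, pointer and value), and two
  for the result and the multiplication.
\<close>

lemma runs_Assign_then:
  assumes "loc_fits s l" "operand_fits s u" "operand_fits s v"
    and "fits (binop_val f (val s u) (val s v))"
    and "f \<in> {MUL, DIV, MOD} \<Longrightarrow> \<bar>val s u\<bar> \<le> int X \<and> \<bar>val s v\<bar> \<le> int X"
    and "runs c (s(addr s l := binop_val f (val s u) (val s v))) k R"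
  shows "runs (Seq (Assign l f u v) c) s (10 + k) R"
proof -
  have "binop_cost B f (val s u) (val s v) \<le> 2 * U"
  proof (cases "f \<in> {MUL, DIV, MOD}")
    case True
    have "nat (bitlen \<bar>x\<bar>) \<le> X" if "\<bar>x\<bar> \<le> int X" for x
      using bitlen_le[of x] that by linarith
    then have "nat (max (bitlen \<bar>val s u\<bar>) (bitlen \<bar>val s v\<bar>)) \<le> X"
      using assms(5)[OF True] by (simp add: max_def)
    from B_le[OF this] show ?thesis
      using assms(4) by (simp add: binop_cost_def)
  next
    case False
    then show ?thesis using assms(4) by (simp add: binop_cost_def)
  qed
  then have "addr_cost s l + val_cost s u + val_cost s v + binop_cost B f (val s u) (val s v) \<le> 10 * U"
    using addr_cost_le[OF assms(1)] val_cost_le[OF assms(2)] val_cost_le[OF assms(3)] by linarith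
  then have "runs (Assign l f u v) s 10 (\<lambda>s1. runs c s1 k R)"
    unfolding runs_def[of "Assign l f u v"] using exec_Assign assms(6) by blast
  then show ?thesis by (rule runs_Seq)
qed

lemma test_cost_le:
  assumes "b = LESS u v \<or> b = EQUAL u v" "operand_fits s u" "operand_fits s v"
  shows "test_cost s b \<le> 6 * U"
  using assms val_cost_le[of s u] val_cost_le[of s v] by auto

lemma runs_Cond_EQUAL_then:
  assumes "operand_fits s u" "operand_fits s v"
    and "val s u = val s v \<Longrightarrow> runs (Seq c1 c) s k R"
    and "val s u \<noteq> val s v \<Longrightarrow> runs (Seq c2 c) s k R"
  shows "runs (Seq (Cond (EQUAL u v) c1 c2) c) s (6 + k) R"
proof -
  have cost: "test_cost s (EQUAL u v) \<le> 6 * U"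
    using test_cost_le assms(1,2) by blast
  have "runs (Seq (if val s u = val s v then c1 else c2) c) s k R"
    using assms(3,4) by simp
  then obtain t s' where t: "exec B (Seq (if val s u = val s v then c1 else c2) c) s t s'"
      "t \<le> k * U" "R s'"
    by (auto simp: runs_def)
  from t(1) obtain t1 s1 t2 where
    1: "exec B (if val s u = val s v then c1 else c2) s t1 s1" and
    2: "exec B c s1 t2 s'" and sum: "t = t1 + t2"
    by (auto elim: exec.cases)
  have "exec B (Cond (EQUAL u v) c1 c2) s (test_cost s (EQUAL u v) + t1) s1"
    using 1 exec_Cond_True[of s "EQUAL u v" B c1 t1 s1 c2] exec_Cond_False[of s "EQUAL u v" B c2 t1 s1 c1]
    by (cases "val s u = val s v") simp_all
  from exec_Seq[OF this 2] have "exec B (Seq (Cond (EQUAL u v) c1 c2) c) s (test_cost s (EQUAL u v) + t1 + t2) s'" .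
  moreover have "test_cost s (EQUAL u v) + t1 + t2 \<le> (6 + k) * U"
    using sum cost t(2) by (simp add: distrib_right)
  ultimately show ?thesis
    unfolding runs_def using t(3) by blast
qed

text \<open>
  The invariant \<open>I k\<close> holds after \<open>k\<close> rounds, and each evaluation of the test takes at most six units.
\<close>

lemma runs_count_up:
  assumes test: "\<And>k s. k \<le> N \<Longrightarrow> I k s \<Longrightarrow>
      operand_fits s u \<and> operand_fits s v \<and> val s u = int k \<and> val s v = int N"
    and body: "\<And>k s. k < N \<Longrightarrow> I k s \<Longrightarrow> runs c s K (I (Suc k))"
    and init: "I 0 s"
  shows "runs (While (LESS u v) c) s (N * (K + 6) + 6) (I N)"
proof -
  have "runs (While (LESS u v) c) s ((N - k) * (K + 6) + 6) (I N)" if "k \<le> N" "I k s" for k s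
    using that
  proof (induction "N - k" arbitrary: k s)
    case 0
    then have "test_cost s (LESS u v) \<le> 6 * U" "\<not> test_val s (LESS u v)" "k = N"
      using test[of k s] test_cost_le[of "LESS u v" u v s] by auto
    then show ?case
      unfolding runs_def using exec_While_False[of s "LESS u v" B c] 0 by fastforce
  next
    case (Suc l)
    then have k: "k < N" by simp
    have cost: "test_cost s (LESS u v) \<le> 6 * U" and true: "test_val s (LESS u v)"
      using test[of k s] test_cost_le[of "LESS u v" u v s] Suc.prems k by auto
    obtain t1 s1 where 1: "exec B c s t1 s1" "t1 \<le> K * U" "I (Suc k) s1"
      using body[OF k Suc.prems(2)] by (auto simp: runs_def)
    obtain t2 s2 where 2: "exec B (While (LESS u v) c) s1 t2 s2" "t2 \<le> ((N - Suc k) * (K + 6) + 6) * U" "I N s2"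
    proof -
      have "l = N - Suc k" using Suc.hyps(2) by simp
      from Suc.hyps(1)[OF this _ 1(3)] k show ?thesis
        using that by (auto simp: runs_def)
    qed
    have "exec B (While (LESS u v) c) s (test_cost s (LESS u v) + t1 + t2) s2"
      by (rule exec_While_True[OF true 1(1) 2(1)])
    moreover have "N - k = Suc (N - Suc k)" using k by simp
    then have "test_cost s (LESS u v) + t1 + t2 \<le> ((N - k) * (K + 6) + 6) * U"
      using cost 1(2) 2(2) by (simp add: distrib_right)
    ultimately show ?case
      using 2(3) unfolding runs_def by blast
  qed
  from this[of 0 s] show ?thesis using init by simp
qed

lemma runs_count_up_then:
  assumes "\<And>k s. k \<le> N \<Longrightarrow> I k s \<Longrightarrow>
      operand_fits s u \<and> operand_fits s v \<and> val s u = int k \<and> val s v = int N"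
    and "\<And>k s. k < N \<Longrightarrow> I k s \<Longrightarrow> runs c s K (I (Suc k))"
    and "I 0 s"
    and "\<And>s'. I N s' \<Longrightarrow> runs c' s' k R"
  shows "runs (Seq (While (LESS u v) c) c') s (N * (K + 6) + 6 + k) R"
proof (rule runs_Seq)
  have "runs (While (LESS u v) c) s (N * (K + 6) + 6) (I N)"
    by (rule runs_count_up[where I = I]) (fact assms)+
  then show "runs (While (LESS u v) c) s (N * (K + 6) + 6) (\<lambda>s'. runs c' s' k R)"
    by (rule runs_mono) (use assms(4) in auto)
qed

end


section \<open>Scaling the columns\<close>

text \<open>
  The bodies of the inner and of the outer loop of \<open>scale_columns\<close>, named so that each can have a
  specification of its own.
\<close>

definition write_denominator :: com where
  "write_denominator = block [
     Assign reg_p MUL (Val reg_j) (Val reg_n),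
     Assign reg_p ADD (Val reg_p) (Val reg_i),
     Assign reg_p ADD (Val reg_p) (Val reg_d),
     copy at_p (Lit 1),
     Cond (EQUAL (Val reg_a) (Lit 1)) Skip (copy at_p (Val reg_a)),
     Assign reg_j ADD (Val reg_j) (Lit 1)]"

definition scale_column :: com where
  "scale_column = block [
     Assign reg_p MUL (Val reg_i) (Val reg_n),
     Assign reg_p ADD (Val reg_p) (Val reg_i),
     Assign reg_p ADD (Val reg_p) (Lit 2),
     copy reg_a (Val at_p),
     copy reg_j (Lit 0),
     While (LESS (Val reg_j) (Val reg_n)) write_denominator,
     Assign reg_i ADD (Val reg_i) (Lit 1)]"

lemma scale_columns_unfold:
  "scale_columns = block [
     Assign reg_d MUL (Val reg_m) (Val reg_n),
     Assign reg_p MUL (Val reg_n) (Val reg_n),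
     Assign reg_d ADD (Val reg_d) (Val reg_p),
     Assign reg_d ADD (Val reg_d) (Lit 2),
     copy reg_i (Lit 0),
     While (LESS (Val reg_i) (Val reg_n)) scale_column]"
  by (simp add: scale_columns_def scale_column_def write_denominator_def)

lemma (in cost_unit) fits_constants:
  assumes "5 \<le> X"
  shows "fits 0" "fits 1" "fits 2" "fits (-1)" "fits (-2)" "fits (-3)" "fits (-4)" "fits (-5)"
  using assms by (auto intro!: bit_len_le_U)

lemma (in cost_unit) runs_write_denominator:
  assumes regs: "s (-1) = i" "s (-2) = j" "s (-4) = d" "s 1 = n" and a: "fits (s (-3))"
    and p: "j * n + i + d = p" "0 < p" "p \<noteq> 1"
    and bounds: "\<bar>i\<bar> \<le> int X" "\<bar>j\<bar> \<le> int X" "\<bar>d\<bar> \<le> int X" "\<bar>n\<bar> \<le> int X" "\<bar>j * n\<bar> \<le> int X"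
      "\<bar>j * n + i\<bar> \<le> int X" "\<bar>p\<bar> \<le> int X" "\<bar>j + 1\<bar> \<le> int X" "5 \<le> X"
  shows "runs write_denominator s 70
    (\<lambda>s'. s' p = s (-3) \<and> s' (-2) = j + 1 \<and> (\<forall>x. x \<notin> {p, -2, -5} \<longrightarrow> s' x = s x))"
proof -
  have pneg: "p \<noteq> -1" "p \<noteq> -2" "p \<noteq> -3" "p \<noteq> -4" "p \<noteq> -5"
    using p(2) by auto
  note fits = bounds(1-8)[THEN bit_len_le_U] fits_constants[OF bounds(9)]
  have "runs write_denominator s (10 + (10 + (10 + (10 + (6 + (10 + (10 + 1)))))))
    (\<lambda>s'. s' p = s (-3) \<and> s' (-2) = j + 1 \<and> (\<forall>x. x \<notin> {p, -2, -5} \<longrightarrow> s' x = s x))"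
    unfolding write_denominator_def block.simps
    by (intro runs_Assign_then runs_Cond_EQUAL_then runs_Skip_then runs_Skip)
       (simp_all add: regs a p pneg bounds(2,4) fits)
  then show ?thesis by (rule runs_mono) auto
qed

text \<open>
  The memory \<open>r\<close> is the one that the Smith normal form routine leaves behind. The summand \<open>5\<close> makes the
  addresses of the five registers small as well.
\<close>

locale scaling_run = cost_unit +
  fixes m n :: nat and r :: memory
  assumes r0: "r 0 = int m" and r1: "r 1 = int n" and nm: "n \<le> m" and npos: "0 < n"
    and X: "D_base m n + n * n + 5 \<le> X"
    and diagonal_fits: "i < n \<Longrightarrow> bit_len (r (int (S_base + i * n + i))) \<le> U"
begin

definition diag :: "nat \<Rightarrow> int" where
  "diag i = r (int (S_base + i * n + i))"

definition den_addr :: "nat \<Rightarrow> nat \<Rightarrow> int" where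
  "den_addr j i = int j * int n + int i + int (D_base m n)"

text \<open>
  The loop invariants. Everything below the matrix of denominators, that is, the dimensions, \<open>S\<close> and \<open>Q\<close>,
  stays as in \<open>r\<close>.
\<close>

definition columns_scaled :: "nat \<Rightarrow> memory \<Rightarrow> bool" where
  "columns_scaled k s \<longleftrightarrow>
     (\<forall>x. 0 \<le> x \<and> x < int (D_base m n) \<longrightarrow> s x = r x) \<and>
     (\<forall>i<k. \<forall>j<n. s (den_addr j i) = diag i) \<and>
     s (-1) = int k \<and> s (-4) = int (D_base m n)"

definition entries_scaled :: "nat \<Rightarrow> nat \<Rightarrow> memory \<Rightarrow> bool" where
  "entries_scaled k l s \<longleftrightarrow>
     columns_scaled k s \<and> (\<forall>j<l. s (den_addr j k) = diag k) \<and> s (-2) = int l \<and> s (-3) = diag k"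

lemma index_bound: "j < n \<Longrightarrow> i < n \<Longrightarrow> j * n + i < n * n"
proof -
  assume "j < n" "i < n"
  then have "j * n + i < Suc j * n" by simp
  also have "\<dots> \<le> n * n" using \<open>j < n\<close> by (intro mult_le_mono1) simp
  finally show ?thesis .
qed

text \<open>
  Row-major addressing is injective, so a new denominator does not overwrite an earlier one.
\<close>

lemma den_addr_inj: "i < n \<Longrightarrow> i' < n \<Longrightarrow> den_addr j i = den_addr j' i' \<longleftrightarrow> j = j' \<and> i = i'"
proof
  assume "i < n" "i' < n" "den_addr j i = den_addr j' i'"
  then have eq: "j * n + i = j' * n + i'"
    by (simp add: den_addr_def flip: of_nat_mult of_nat_add)
  have "i = i'"
    using arg_cong[OF eq, of "\<lambda>k. k mod n"] \<open>i < n\<close> \<open>i' < n\<close> by simp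
  then show "j = j' \<and> i = i'" using eq npos by simp
qed simp

lemma den_addr_ge: "int (D_base m n) \<le> den_addr j i"
  by (simp add: den_addr_def)

lemma D_base_ge: "3 \<le> D_base m n"
proof -
  have "0 < m * n" using npos nm by simp
  then show ?thesis unfolding D_base_def Q_base_def S_base_def by linarith
qed

lemma den_addr_not_register [simp]:
  "den_addr j i \<noteq> -1" "den_addr j i \<noteq> -2" "den_addr j i \<noteq> -3" "den_addr j i \<noteq> -4" "den_addr j i \<noteq> -5"
  "0 < den_addr j i" "den_addr j i \<noteq> 1"
  using den_addr_ge[of j i] D_base_ge by simp_all

lemma dims_le_products: "m \<le> m * n" "n \<le> n * n"
  using npos by simp_all

lemma X_bounds:
  "m * n + n * n + n * n + 7 \<le> X"
  using X by (simp add: D_base_def Q_base_def S_base_def)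

lemma small_constants_fit: "fits 0" "fits 1" "fits 2" "fits (-1)" "fits (-2)" "fits (-3)" "fits (-4)" "fits (-5)"
  using fits_constants X_bounds by simp_all

lemma entries_scaled_step:
  assumes k: "k < n" and l: "l < n" and s: "entries_scaled k l s"
  shows "runs write_denominator s 70 (entries_scaled k (Suc l))"
proof -
  have ln: "l * n + k < n * n" "l * n \<le> n * n" using index_bound[OF l k] l by simp_all
  have s_int: "s 1 = int n"
    using s D_base_ge r1 by (simp add: entries_scaled_def columns_scaled_def)
  have X': "int (l * n + k) \<le> int X" "int (l * n) \<le> int X" "int (D_base m n + (l * n + k)) \<le> int X"
     "int n \<le> int X" "int (D_base m n) \<le> int X" "int (Suc l) \<le> int X"
    unfolding of_nat_le_iff using ln X dims_le_products l by linarith+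
  have a: "fits (s (-3))"
    using diagonal_fits[OF k] s by (simp add: entries_scaled_def diag_def)
  have "runs write_denominator s 70
    (\<lambda>s'. s' (den_addr l k) = s (-3) \<and> s' (-2) = int l + 1 \<and>
      (\<forall>x. x \<notin> {den_addr l k, -2, -5} \<longrightarrow> s' x = s x))"
    by (rule runs_write_denominator[where i = "int k" and d = "int (D_base m n)" and n = "int n"])
       (use s a s_int X' X D_base_ge den_addr_not_register(6,7)[of l k] k l in
          \<open>simp_all add: entries_scaled_def columns_scaled_def den_addr_def\<close>)
  then show ?thesis
  proof (rule runs_mono)
    fix s' assume s': "s' (den_addr l k) = s (-3) \<and> s' (-2) = int l + 1 \<and>
      (\<forall>x. x \<notin> {den_addr l k, -2, -5} \<longrightarrow> s' x = s x)"
    have low: "s' x = s x" if "0 \<le> x" "x < int (D_base m n)" for x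
      using s' that den_addr_ge[of l k] by auto
    have other: "s' (den_addr j i) = s (den_addr j i)" if "i < n" "(j, i) \<noteq> (l, k)" for j i
      using s' that den_addr_inj[OF that(1) k, of j l] den_addr_ge[of j i] D_base_ge by auto
    have regs: "s' (-1) = s (-1)" "s' (-3) = s (-3)" "s' (-4) = s (-4)"
      using s' den_addr_ge[of l k] D_base_ge by auto
    show "entries_scaled k (Suc l) s'"
      using s s' k by (auto simp: entries_scaled_def columns_scaled_def low other regs less_Suc_eq)
  qed simp
qed

lemma columns_scaled_step:
  assumes k: "k < n" and s: "columns_scaled k s"
  shows "runs scale_column s (76 * n + 67) (columns_scaled (Suc k))"
proof -
  have kn: "k * n + k < n * n" "k * n \<le> n * n" using index_bound[OF k k] k by simp_all
  have s1: "s 1 = int n" and sk: "s (-1) = int k"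
    using s D_base_ge r1 by (simp_all add: columns_scaled_def)
  \<comment> \<open>The address of \<open>S(k, k)\<close>, in the form in which the program computes it.\<close>
  define p where "p = int k * int n + int k + 2"
  have p: "0 \<le> p" "p < int (D_base m n)" "p = int (S_base + k * n + k)"
  proof -
    have "n * n \<le> m * n" using nm by simp
    then have "2 + (k * n + k) < D_base m n"
      using kn(1) by (simp add: D_base_def Q_base_def S_base_def)
    then have "int (2 + (k * n + k)) < int (D_base m n)" by (simp only: of_nat_less_iff)
    then show "p < int (D_base m n)" by (simp add: p_def)
  qed (simp_all add: p_def S_base_def)
  then have sp: "s p = diag k" using s by (simp add: columns_scaled_def diag_def)
  have X': "int (k * n + k) \<le> int X" "int (k * n) \<le> int X" "int n \<le> int X" "int (Suc k) \<le> int X" "int 5 \<le> int X"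
    unfolding of_nat_le_iff using kn X_bounds dims_le_products k by linarith+
  have X'': "int k * int n + int k \<le> int X" "int k * int n \<le> int X" "p \<le> int X"
    using X' p X by (simp_all)
  have fits: "fits (int k * int n + int k)" "fits (int k * int n)" "fits p" "fits (int n)" "fits (int k)"
      "fits (int k + 1)"
    using X' X'' p(1) by (auto intro!: bit_len_le_U)
  have loop: "runs (Seq (While (LESS (Val reg_j) (Val reg_n)) write_denominator)
      (Seq (Assign reg_i ADD (Val reg_i) (Lit 1)) Skip)) s' (n * (70 + 6) + 6 + (10 + 1)) (columns_scaled (Suc k))"
    if "entries_scaled k 0 s'" for s'
  proof (rule runs_count_up_then[where I = "entries_scaled k"])
    fix l s assume l: "l \<le> n" and s: "entries_scaled k l s"
    have "s 1 = int n" using s D_base_ge r1 by (simp_all add: entries_scaled_def columns_scaled_def)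
    moreover have "fits (int l)" using l X'(3) by (intro bit_len_le_U) simp
    ultimately show "operand_fits s (Val reg_j) \<and> operand_fits s (Val reg_n) \<and>
        val s (Val reg_j) = int l \<and> val s (Val reg_n) = int n"
      using s fits small_constants_fit by (simp add: entries_scaled_def)
  next
    fix s' assume s': "entries_scaled k n s'"
    have upd: "columns_scaled (Suc k) (s'(-1 := int k + 1))"
      using s' den_addr_ge D_base_ge
      by (auto simp: entries_scaled_def columns_scaled_def less_Suc_eq)
    have "s' (-1) = int k"
      using s' by (simp add: entries_scaled_def columns_scaled_def)
    then show "runs (Seq (Assign reg_i ADD (Val reg_i) (Lit 1)) Skip) s' (10 + 1) (columns_scaled (Suc k))"
      by (intro runs_Assign_then runs_Skip) (use upd fits small_constants_fit in simp_all)
  next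
    show "runs write_denominator s 70 (entries_scaled k (Suc l))" if "l < n" "entries_scaled k l s" for l s
      by (rule entries_scaled_step[OF k that])
  qed (rule that)
  have upd: "entries_scaled k 0 (s(-5 := p, -3 := diag k, -2 := 0))"
    using s den_addr_ge D_base_ge
    by (auto simp: entries_scaled_def columns_scaled_def)
  have p_regs: "p \<noteq> -1" "p \<noteq> -2" "p \<noteq> -3" "p \<noteq> -4" "p \<noteq> -5"
    using p(1) by auto
  have le_X: "k \<le> X" "n \<le> X"
    using X' by simp_all
  have diag_fits: "fits (diag k)"
    using diagonal_fits[OF k] by (simp add: diag_def)
  have "runs scale_column s (10 + (10 + (10 + (10 + (10 + (n * (70 + 6) + 6 + (10 + 1))))))) (columns_scaled (Suc k))"
    unfolding scale_column_def block.simps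
    by (intro runs_Assign_then loop)
       (simp_all add: s1 sk sp p_regs le_X fits small_constants_fit upd diag_fits p_def[symmetric])
  then show ?thesis by (rule runs_mono) auto
qed

text \<open>
  The factor is generous: each of the \<open>n\<^sup>2\<close> rounds of the inner loop costs at most \<open>76\<close> units, each round
  of the outer loop \<open>73\<close> more.
\<close>

lemma runs_scale_columns: "runs scale_columns r (200 * (n + 1) ^ 2) (columns_scaled n)"
proof -
  have X': "int (m * n + n * n) \<le> int X" "int (m * n) \<le> int X" "int (n * n) \<le> int X"
     "int m \<le> int X" "int n \<le> int X" "int 5 \<le> int X" "int (D_base m n) \<le> int X"
    unfolding of_nat_le_iff using X X_bounds dims_le_products by linarith+
  have D: "int m * int n + int n * int n + 2 = int (D_base m n)"
    by (simp add: D_base_def Q_base_def S_base_def)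
  have le_X: "m \<le> X" "n \<le> X"
    using X' by simp_all
  have fits: "fits (int m * int n)" "fits (int n * int n)" "fits (int m * int n + int n * int n)"
      "fits (int (D_base m n))" "fits (int m)" "fits (int n)"
    using X' by (auto intro!: bit_len_le_U)
  have loop: "runs (Seq (While (LESS (Val reg_i) (Val reg_n)) scale_column) Skip) s
      (n * (76 * n + 67 + 6) + 6 + 1) (columns_scaled n)" if "columns_scaled 0 s" for s
  proof (rule runs_count_up_then[where I = columns_scaled])
    fix l s assume l: "l \<le> n" and s: "columns_scaled l s"
    have "s 1 = int n" using s D_base_ge r1 by (simp_all add: columns_scaled_def)
    moreover have "fits (int l)" "fits (int n)" using l X' by (auto intro!: bit_len_le_U)
    ultimately show "operand_fits s (Val reg_i) \<and> operand_fits s (Val reg_n) \<and>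
        val s (Val reg_i) = int l \<and> val s (Val reg_n) = int n"
      using s fits small_constants_fit by (simp add: columns_scaled_def)
  next
    show "runs Skip s' 1 (columns_scaled n)" if "columns_scaled n s'" for s'
      using that by (rule runs_Skip)
  next
    show "runs scale_column s (76 * n + 67) (columns_scaled (Suc k))" if "k < n" "columns_scaled k s" for k s
      by (rule columns_scaled_step[OF that])
  qed (rule that)
  have upd: "columns_scaled 0 (r(-1 := 0, -4 := int (D_base m n), -5 := int n * int n))"
    by (auto simp: columns_scaled_def)
  have "runs scale_columns r (10 + (10 + (10 + (10 + (10 + (n * (76 * n + 67 + 6) + 6 + 1)))))) (columns_scaled n)"
    unfolding scale_columns_unfold block.simps
    by (intro runs_Assign_then loop)
       (simp_all add: r0 r1 le_X D fits small_constants_fit upd fun_upd_twist)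
  then show ?thesis
    by (rule runs_mono) (simp_all add: power2_eq_square algebra_simps)
qed

end

section \<open>Polynomially bounded functions\<close>

text \<open>
  The size \<open>N\<close> of the inputs is a parameter. The closure properties assume \<open>N \<ge> 1\<close> on \<open>X\<close>: powers of \<open>N\<close>
  then grow with the exponent, so that two bounds can be given the same one.
\<close>

definition poly_bounded :: "'a set \<Rightarrow> ('a \<Rightarrow> real) \<Rightarrow> ('a \<Rightarrow> real) \<Rightarrow> bool" where
  "poly_bounded X N f \<longleftrightarrow> (\<exists>C d. \<forall>x\<in>X. \<bar>f x\<bar> \<le> C * N x ^ d)"

lemma poly_bounded_leI:
  assumes "poly_bounded X N g" "\<And>x. x \<in> X \<Longrightarrow> \<bar>f x\<bar> \<le> g x"
  shows "poly_bounded X N f"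
  using assms unfolding poly_bounded_def by (meson abs_ge_self order_trans)

lemma poly_bounded_const: "poly_bounded X N (\<lambda>_. c)"
  unfolding poly_bounded_def by (intro exI[of _ "\<bar>c\<bar>"] exI[of _ 0]) simp

lemma poly_bounded_size: "(\<And>x. x \<in> X \<Longrightarrow> 1 \<le> N x) \<Longrightarrow> poly_bounded X N N"
  unfolding poly_bounded_def by (intro exI[of _ 1] exI[of _ 1]) force

lemma poly_bounded_nonneg_constant:
  assumes N: "\<And>x. x \<in> X \<Longrightarrow> 1 \<le> N x" and f: "poly_bounded X N f"
  obtains C d where "C \<ge> 0" "\<And>x. x \<in> X \<Longrightarrow> \<bar>f x\<bar> \<le> C * N x ^ d"
proof -
  obtain C d where C: "\<forall>x\<in>X. \<bar>f x\<bar> \<le> C * N x ^ d"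
    using f by (auto simp: poly_bounded_def)
  have "\<bar>f x\<bar> \<le> \<bar>C\<bar> * N x ^ d" if x: "x \<in> X" for x
  proof -
    have "C * N x ^ d \<le> \<bar>C\<bar> * N x ^ d"
      using N[OF x] by (intro mult_right_mono) auto
    then show ?thesis using C x by force
  qed
  then show ?thesis using that[of "\<bar>C\<bar>" d] by simp
qed

lemma poly_bounded_add:
  assumes N: "\<And>x. x \<in> X \<Longrightarrow> 1 \<le> N x" and f: "poly_bounded X N f" and g: "poly_bounded X N g"
  shows "poly_bounded X N (\<lambda>x. f x + g x)"
proof -
  obtain C d where C: "C \<ge> 0" "\<And>x. x \<in> X \<Longrightarrow> \<bar>f x\<bar> \<le> C * N x ^ d"
    using poly_bounded_nonneg_constant[OF N f] by blast
  obtain D e where D: "D \<ge> 0" "\<And>x. x \<in> X \<Longrightarrow> \<bar>g x\<bar> \<le> D * N x ^ e"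
    using poly_bounded_nonneg_constant[OF N g] by blast
  have "\<bar>f x + g x\<bar> \<le> (C + D) * N x ^ (d + e)" if x: "x \<in> X" for x
  proof -
    have "C * N x ^ d \<le> C * N x ^ (d + e)" "D * N x ^ e \<le> D * N x ^ (d + e)"
      using N[OF x] C(1) D(1) by (auto intro!: mult_left_mono power_increasing)
    then show ?thesis using C(2)[OF x] D(2)[OF x] by (simp add: distrib_right)
  qed
  then show ?thesis unfolding poly_bounded_def by blast
qed

lemma poly_bounded_mult:
  assumes N: "\<And>x. x \<in> X \<Longrightarrow> 1 \<le> N x" and f: "poly_bounded X N f" and g: "poly_bounded X N g"
  shows "poly_bounded X N (\<lambda>x. f x * g x)"
proof -
  obtain C d where C: "C \<ge> 0" "\<And>x. x \<in> X \<Longrightarrow> \<bar>f x\<bar> \<le> C * N x ^ d"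
    using poly_bounded_nonneg_constant[OF N f] by blast
  obtain D e where D: "D \<ge> 0" "\<And>x. x \<in> X \<Longrightarrow> \<bar>g x\<bar> \<le> D * N x ^ e"
    using poly_bounded_nonneg_constant[OF N g] by blast
  have "\<bar>f x * g x\<bar> \<le> (C * D) * N x ^ (d + e)" if x: "x \<in> X" for x
  proof -
    have "\<bar>f x\<bar> * \<bar>g x\<bar> \<le> (C * N x ^ d) * (D * N x ^ e)"
      using C(2)[OF x] D(2)[OF x] C(1) N[OF x] by (intro mult_mono) auto
    then show ?thesis by (simp add: abs_mult power_add mult_ac)
  qed
  then show ?thesis unfolding poly_bounded_def by blast
qed

lemma poly_bounded_power:
  assumes N: "\<And>x. x \<in> X \<Longrightarrow> 1 \<le> N x" and f: "poly_bounded X N f"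
  shows "poly_bounded X N (\<lambda>x. f x ^ k)"
  by (induction k) (simp_all add: poly_bounded_const poly_bounded_mult[OF N f])

lemma log1_bounds: "0 \<le> log1 x" "log1 x \<le> 2 + \<bar>x\<bar>"
proof -
  \<comment> \<open>For \<open>y > 1\<close>, round \<open>y\<close> up to \<open>k\<close> and use \<open>k \<le> 2 ^ (k - 1)\<close> and \<open>k - 1 \<le> y\<close>.\<close>
  have "log 2 y \<le> y" if "y > 0" for y :: real
  proof -
    have "y \<le> 2 powr y"
    proof (cases "y \<le> 1")
      case True
      have "(1::real) \<le> 2 powr y" using \<open>y > 0\<close> by (simp add: ge_one_powr_ge_zero)
      then show ?thesis using True by linarith
    next
      case False
      have "y \<le> real (nat \<lceil>y\<rceil>)" by linarith
      also have "\<dots> \<le> 2 ^ (nat \<lceil>y\<rceil> - 1)"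
      proof -
        have "nat \<lceil>y\<rceil> \<le> 2 ^ (nat \<lceil>y\<rceil> - 1)"
          using less_exp[of "nat \<lceil>y\<rceil> - 1"] by linarith
        then show ?thesis by (metis of_nat_le_iff of_nat_numeral of_nat_power)
      qed
      also have "\<dots> = 2 powr real (nat \<lceil>y\<rceil> - 1)" by (simp add: powr_realpow)
      also have "\<dots> \<le> 2 powr y" using False by (intro powr_mono) linarith+
      finally show ?thesis .
    qed
    then show ?thesis using that by (simp add: log_le_iff)
  qed
  from this[of "max 2 x"] have "log1 x \<le> max 2 x" by (simp add: log1_def)
  then show "log1 x \<le> 2 + \<bar>x\<bar>" by linarith
  show "0 \<le> log1 x" by (simp add: log1_def)
qed

text \<open>
  A logarithm is at most linear, so \<open>log1 (g x) ^ k\<close> is bounded by a polynomial in \<open>\<bar>g x\<bar>\<close>.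
\<close>

lemma soft_O_poly_bounded:
  assumes N: "\<And>x. x \<in> X \<Longrightarrow> 1 \<le> N x" and f: "f \<in> soft_O X g" and g: "poly_bounded X N g"
  shows "poly_bounded X N f"
proof -
  obtain C k where C: "\<forall>x\<in>X. \<bar>f x\<bar> \<le> C * (g x * log1 (g x) ^ k)"
    using f by (auto simp: soft_O_def)
  have "poly_bounded X N (\<lambda>x. \<bar>g x\<bar>)"
    using g by (simp add: poly_bounded_def)
  then have "poly_bounded X N (\<lambda>x. \<bar>C\<bar> * (\<bar>g x\<bar> * (2 + \<bar>g x\<bar>) ^ k))"
    by (intro poly_bounded_mult poly_bounded_power poly_bounded_add poly_bounded_const N)
  then show ?thesis
  proof (rule poly_bounded_leI)
    fix x assume x: "x \<in> X"
    have "\<bar>f x\<bar> \<le> \<bar>C * (g x * log1 (g x) ^ k)\<bar>"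
      using C x by force
    also have "\<dots> = \<bar>C\<bar> * (\<bar>g x\<bar> * log1 (g x) ^ k)"
      by (simp add: abs_mult log1_bounds)
    also have "\<dots> \<le> \<bar>C\<bar> * (\<bar>g x\<bar> * (2 + \<bar>g x\<bar>) ^ k)"
      by (intro mult_left_mono power_mono log1_bounds) auto
    finally show "\<bar>f x\<bar> \<le> \<bar>C\<bar> * (\<bar>g x\<bar> * (2 + \<bar>g x\<bar>) ^ k)" .
  qed
qed

text \<open>
  The finitely many values before the asymptotic bound sets in are absorbed into the constant; \<open>t + 1\<close>
  in place of \<open>t\<close> takes care of \<open>t = 0\<close>.
\<close>

lemma bigo_power_global_bound:
  assumes "(\<lambda>t. real (B t)) \<in> O(\<lambda>t. real t ^ d)"
  obtains K :: nat where "\<And>t. B t \<le> K * (t + 1) ^ d"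
proof -
  obtain c where "\<forall>\<^sub>F t in sequentially. norm (real (B t)) \<le> c * norm (real t ^ d)"
    using assms by (elim landau_o.bigE)
  then obtain t0 where t0: "\<And>t. t \<ge> t0 \<Longrightarrow> real (B t) \<le> c * real t ^ d"
    by (auto simp: eventually_sequentially)
  define K where "K = nat \<lceil>\<bar>c\<bar>\<rceil> + (\<Sum>t<t0. B t)"
  have "B t \<le> K * (t + 1) ^ d" for t
  proof (cases "t < t0")
    case True
    then have "B t \<le> K * 1"
      unfolding K_def by (simp add: member_le_sum trans_le_add2)
    also have "\<dots> \<le> K * (t + 1) ^ d" by (intro mult_le_mono2) simp
    finally show ?thesis .
  next
    case False
    then have "real (B t) \<le> c * real t ^ d" using t0 by simp
    also have "\<dots> \<le> real K * real (t + 1) ^ d"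
    proof (intro mult_mono power_mono)
      show "c \<le> real K" unfolding K_def by linarith
    qed auto
    also have "\<dots> = real (K * (t + 1) ^ d)" by simp
    finally show ?thesis by (simp only: of_nat_le_iff)
  qed
  then show ?thesis by (rule that)
qed

definition input_size :: "int mat \<Rightarrow> real" where
  "input_size A = real (dim_row A) + real (dim_col A) + real_of_int (mat_norm A)"

lemma mat_norm_ge:
  assumes "i < dim_row A" "j < dim_col A"
  shows "\<bar>A $$ (i, j)\<bar> \<le> mat_norm A"
proof -
  have "A $$ (i, j) \<in> elements_mat A"
    using assms by (intro elements_matI[of A]) auto
  moreover have "finite (elements_mat A)"
    by (simp add: elements_mat_def)
  ultimately show ?thesis
    unfolding mat_norm_def by simp
qed

text \<open>
  The real exponent \<open>\<theta> - 1\<close> can be rounded up to a natural number because the base \<open>m\<close> is at least \<open>1\<close>.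
\<close>

lemma poly_bounded_storjohann_bound:
  assumes B: "\<And>t. B t \<le> K * (t + 1) ^ d" and Y: "\<And>A. A \<in> Y \<Longrightarrow> 0 < dim_row A \<and> 0 < dim_col A"
  shows "poly_bounded Y input_size (storjohann_bound B \<theta>)"
proof -
  have norm: "0 \<le> mat_norm A" if "A \<in> Y" for A
    using mat_norm_ge[of 0 A 0] Y[OF that] by linarith
  have N: "1 \<le> input_size A" if "A \<in> Y" for A
    using Y[OF that] norm[OF that] by (simp add: input_size_def)
  define p where "p = nat \<lceil>\<bar>\<theta> - 1\<bar>\<rceil>"
  have "poly_bounded Y input_size (\<lambda>A. input_size A ^ p * input_size A *
      (real K * (input_size A * (2 + input_size A) + 2) ^ d))"
    by (intro poly_bounded_mult poly_bounded_power poly_bounded_add poly_bounded_const poly_bounded_size N)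
  then show ?thesis
  proof (rule poly_bounded_leI)
    fix A assume A: "A \<in> Y"
    let ?m = "real (dim_row A)" and ?n = "real (dim_col A)" and ?l = "log1 (real_of_int (mat_norm A))"
    have m: "1 \<le> ?m" "?m \<le> input_size A" and n: "?n \<le> input_size A" and norm_le: "real_of_int (mat_norm A) \<le> input_size A"
      using Y[OF A] norm[OF A] by (auto simp: input_size_def)
    have "?m powr (\<theta> - 1) \<le> ?m powr real p"
      using m by (intro powr_mono) (auto simp: p_def, linarith)
    also have "\<dots> \<le> input_size A ^ p"
      using m by (simp add: powr_realpow power_mono)
    finally have 1: "?m powr (\<theta> - 1) \<le> input_size A ^ p" .
    have "?m * ?l \<le> input_size A * (2 + input_size A)"
      using m log1_bounds[of "real_of_int (mat_norm A)"] norm_le norm[OF A] by (intro mult_mono) auto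
    moreover have "0 \<le> ?m * ?l" using log1_bounds by simp
    then have "real (nat \<lceil>?m * ?l\<rceil>) \<le> ?m * ?l + 1" by linarith
    ultimately have "real (nat \<lceil>?m * ?l\<rceil>) + 1 \<le> input_size A * (2 + input_size A) + 2"
      by linarith
    then have "(real (nat \<lceil>?m * ?l\<rceil>) + 1) ^ d \<le> (input_size A * (2 + input_size A) + 2) ^ d"
      by (intro power_mono) auto
    moreover have "real (B (nat \<lceil>?m * ?l\<rceil>)) \<le> real K * (real (nat \<lceil>?m * ?l\<rceil>) + 1) ^ d"
      using of_nat_mono[OF B[of "nat \<lceil>?m * ?l\<rceil>"], where 'a = real] by (simp add: add.commute)
    ultimately have 2: "real (B (nat \<lceil>?m * ?l\<rceil>)) \<le> real K * (input_size A * (2 + input_size A) + 2) ^ d"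
      by (meson mult_left_mono of_nat_0_le_iff order_trans)
    have "storjohann_bound B \<theta> A \<le> input_size A ^ p * input_size A *
        (real K * (input_size A * (2 + input_size A) + 2) ^ d)"
      unfolding storjohann_bound_def Let_def
      using 1 2 n N[OF A] by (intro mult_mono) auto
    moreover have "0 \<le> storjohann_bound B \<theta> A"
      by (simp add: storjohann_bound_def Let_def)
    ultimately show "\<bar>storjohann_bound B \<theta> A\<bar> \<le> input_size A ^ p * input_size A *
        (real K * (input_size A * (2 + input_size A) + 2) ^ d)" by simp
  qed
qed

section \<open>The whole algorithm\<close>

text \<open>
  A cell of \<open>S\<close> either was written by the routine, and then its length is at most the cost \<open>t\<close>, or still
  holds the entry of \<open>A\<close>.
\<close>

lemma routine_cells_fit:
  assumes run: "exec B snf (load_mat A) t s" and ij: "i < dim_row A" "j < dim_col A"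
  shows "bit_len (s (int (S_base + i * dim_col A + j))) \<le> t + nat (mat_norm A) + 1"
proof -
  let ?x = "int (S_base + i * dim_col A + j)"
  consider "s ?x = load_mat A ?x" | "bit_len (s ?x) \<le> t"
    using exec_bit_len_le_cost[OF run] by blast
  then show ?thesis
  proof cases
    case 1
    have "i * dim_col A + j < Suc i * dim_col A" using ij by simp
    also have "\<dots> \<le> dim_row A * dim_col A" using ij by (intro mult_le_mono1) simp
    finally have "i * dim_col A + j < dim_row A * dim_col A" .
    moreover have "(i * dim_col A + j) div dim_col A = i" "(i * dim_col A + j) mod dim_col A = j"
      using ij by simp_all
    moreover have "load_mat A (int (S_base + k)) = A $$ (k div dim_col A, k mod dim_col A)"
      if "k < dim_row A * dim_col A" for k
      using that by (simp add: load_mat_def Let_def S_base_def)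
    ultimately have "s ?x = A $$ (i, j)"
      unfolding 1 by (metis add.assoc)
    then show ?thesis
      using bit_len_le[of "s ?x"] mat_norm_ge[OF ij] by linarith
  qed simp
qed

definition address_bound :: "int mat \<Rightarrow> nat" where
  "address_bound A = D_base (dim_row A) (dim_col A) + dim_col A * dim_col A + 5"

text \<open>
  The running time \<open>T A\<close> pays for entries that the routine has written, the norm for entries that it
  has not, the address bound for indices and addresses, and the last summand for multiplications.
\<close>

definition unit_bound :: "(int mat \<Rightarrow> nat) \<Rightarrow> nat \<Rightarrow> nat \<Rightarrow> int mat \<Rightarrow> nat" where
  "unit_bound T K d A =
     T A + nat (mat_norm A) + 1 + address_bound A + K * (address_bound A + 1) ^ d"

lemma scaling_run_after_routine:
  assumes B: "\<And>t. B t \<le> K * (t + 1) ^ d" and n: "0 < dim_col A"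
    and run: "exec B snf (load_mat A) (T A) s" and smith: "holds_smith_form A S Q s"
  shows "scaling_run B (address_bound A) (unit_bound T K d A) (dim_row A) (dim_col A) s"
proof
  fix b assume "b \<le> address_bound A"
  then have "B b \<le> K * (address_bound A + 1) ^ d"
    by (intro order_trans[OF B]) (simp add: power_mono)
  then show "B b \<le> unit_bound T K d A" by (simp add: unit_bound_def)
next
  fix x :: int assume "\<bar>x\<bar> \<le> int (address_bound A)"
  then show "bit_len x \<le> unit_bound T K d A"
    using bit_len_le[of x] by (simp add: unit_bound_def)
next
  show nm: "dim_col A \<le> dim_row A" and "s 0 = int (dim_row A)" "s 1 = int (dim_col A)"
    using smith by (auto simp: holds_smith_form_def smith_normal_form_def Let_def)
  fix i assume "i < dim_col A"
  then show "bit_len (s (int (S_base + i * dim_col A + i))) \<le> unit_bound T K d A"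
    using routine_cells_fit[OF run, of i i] nm by (simp add: unit_bound_def)
qed (use n in \<open>simp_all add: address_bound_def\<close>)

lemma (in scaling_run) read_columns_scaled:
  assumes "columns_scaled n s'"
  shows "read_columns s' m n = scaled_columns (read_mat r S_base m n) (read_mat r (Q_base m n) n n)"
proof -
  have Q: "s' (int (Q_base m n + j * n + i)) = r (int (Q_base m n + j * n + i))" if "i < n" "j < n" for i j
  proof -
    have "Q_base m n + j * n + i < D_base m n"
      using index_bound[OF that(2,1)] by (simp add: D_base_def)
    then show ?thesis
      using assms unfolding columns_scaled_def by (meson of_nat_0_le_iff of_nat_less_iff)
  qed
  have D: "s' (int (D_base m n + j * n + i)) = r (int (S_base + i * n + i))" if "i < n" "j < n" for i j
  proof -
    have "int (D_base m n + j * n + i) = den_addr j i" by (simp add: den_addr_def)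
    then show ?thesis using assms that unfolding columns_scaled_def diag_def by metis
  qed
  have S: "read_mat r S_base m n $$ (i, i) = r (int (S_base + i * n + i))" if "i < n" for i
    using that nm by (simp add: read_mat_def)
  have dims: "dim_row (read_mat s b n n) = n" "dim_col (read_mat s b n n) = n" for s b
    by (simp_all add: read_mat_def)
  have entry: "read_mat s b n n $$ (j, i) = s (int (b + j * n + i))" if "i < n" "j < n" for s b i j
    using that by (simp add: read_mat_def)
  show ?thesis
    unfolding read_columns_def scaled_columns_eq
    by (auto intro!: eq_vecI simp: dims Q D S entry simp del: of_nat_add of_nat_mult)
qed

theorem theorem4p10:
  fixes B :: "nat \<Rightarrow> nat" and \<theta> :: real and snf :: com
  assumes "\<exists>d::nat. (\<lambda>t. real (B t)) \<in> O(\<lambda>t. real t ^ d)"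
    and "smith_routine B \<theta> snf"
  shows "\<exists>(C::real) (d::nat). \<forall>n W A.
           0 < n \<and> admissible n W \<and> exponent_matrix n W A \<longrightarrow>
             (\<exists>t s s' S Q t\<^sub>1.
                exec B snf (load_mat A) t\<^sub>1 s \<and>
                holds_smith_form A S Q s \<and>
                exec B (gmax_gens snf) (load_mat A) t s' \<and>
                read_columns s' (dim_row A) n = scaled_columns S Q \<and>
                generate (QZ n) (QZ_class n ` set (read_columns s' (dim_row A) n)) = Gmax A \<and>
                real t \<le> C * (real (dim_row A) + real n + real_of_int (mat_norm A)) ^ d)"
proof -
  obtain K e :: nat where B: "\<And>t. B t \<le> K * (t + 1) ^ e"
    using assms(1) bigo_power_global_bound by meson
  obtain T where
    snf: "\<And>A. A \<in> smith_inputs \<Longrightarrow> \<exists>s S Q. exec B snf (load_mat A) (T A) s \<and> holds_smith_form A S Q s" and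
    T: "(\<lambda>A. real (T A)) \<in> soft_O smith_inputs (storjohann_bound B \<theta>)"
    using assms(2) unfolding smith_routine_def by blast
  define cost where "cost A = T A + 200 * (dim_col A + 1)\<^sup>2 * unit_bound T K e A" for A
  have dims: "0 < dim_row A \<and> 0 < dim_col A" if "A \<in> smith_inputs" for A
    using snf[OF that] that
    by (force simp: smith_inputs_def holds_smith_form_def smith_normal_form_def Let_def)
  have norm: "0 \<le> mat_norm A" if "A \<in> smith_inputs" for A
    using mat_norm_ge[of 0 A 0] dims[OF that] by linarith
  have N: "1 \<le> input_size A" if "A \<in> smith_inputs" for A
    using dims[OF that] norm[OF that] by (simp add: input_size_def)
  have "poly_bounded smith_inputs input_size (\<lambda>A. real (cost A))"
  proof -
    note closure = poly_bounded_add poly_bounded_mult poly_bounded_power poly_bounded_const N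
    have size: "poly_bounded smith_inputs input_size input_size"
      by (rule poly_bounded_size) (rule N)
    have dim: "poly_bounded smith_inputs input_size (\<lambda>A. real (dim_row A))"
        "poly_bounded smith_inputs input_size (\<lambda>A. real (dim_col A))"
        "poly_bounded smith_inputs input_size (\<lambda>A. real (nat (mat_norm A)))"
      by (rule poly_bounded_leI[OF size], use norm in \<open>simp add: input_size_def\<close>)+
    have T_bounded: "poly_bounded smith_inputs input_size (\<lambda>A. real (T A))"
      by (rule soft_O_poly_bounded[OF N T poly_bounded_storjohann_bound[OF B dims]])
    show ?thesis
      unfolding cost_def unit_bound_def address_bound_def D_base_def Q_base_def S_base_def
        of_nat_add of_nat_mult of_nat_power of_nat_numeral of_nat_1
      by (intro closure dim T_bounded)
  qed
  then obtain C d where C: "\<forall>A\<in>smith_inputs. \<bar>real (cost A)\<bar> \<le> C * input_size A ^ d"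
    unfolding poly_bounded_def by blast
  show ?thesis
  proof (rule exI[of _ C], rule exI[of _ d], intro allI impI)
    fix n W A
    assume input: "0 < n \<and> admissible n W \<and> exponent_matrix n W A"
    then have n: "dim_col A = n" by (auto simp: exponent_matrix_def)
    then have A: "A \<in> smith_inputs"
      using input admissible_full_column_rank[of n W A] by (simp add: smith_inputs_def)
    obtain s S Q where s: "exec B snf (load_mat A) (T A) s" "holds_smith_form A S Q s"
      using snf[OF A] by blast
    interpret scaling_run B "address_bound A" "unit_bound T K e A" "dim_row A" n s
      using scaling_run_after_routine[where T = T and K = K and d = e, OF B _ s] dims[OF A] n by simp
    obtain t2 s' where t2: "exec B scale_columns s t2 s'"
        "t2 \<le> 200 * (n + 1)\<^sup>2 * unit_bound T K e A" "columns_scaled n s'"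
      using runs_scale_columns unfolding runs_def by blast
    have cols: "read_columns s' (dim_row A) n = scaled_columns S Q"
      using read_columns_scaled[OF t2(3)] s(2) n by (simp add: holds_smith_form_def Let_def)
    obtain P where "smith_normal_form A P Q S"
      using s(2) by (auto simp: holds_smith_form_def Let_def)
    from Gmax_generated_by_scaled_columns[OF this]
    have gens: "generate (QZ n) (QZ_class n ` set (read_columns s' (dim_row A) n)) = Gmax A"
      using cols n by simp
    have "exec B (gmax_gens snf) (load_mat A) (T A + t2) s'"
      unfolding gmax_gens_def by (rule exec_Seq[OF s(1) t2(1)])
    moreover have "real (T A + t2) \<le> C * (real (dim_row A) + real n + real_of_int (mat_norm A)) ^ d"
    proof -
      have "real (T A + t2) \<le> real (cost A)"
        unfolding cost_def n of_nat_le_iff by (rule add_left_mono[OF t2(2)])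
      also have "\<dots> \<le> C * input_size A ^ d" using C A by force
      finally show ?thesis using n by (simp add: input_size_def)
    qed
    ultimately show "\<exists>t s s' S Q t\<^sub>1.
        exec B snf (load_mat A) t\<^sub>1 s \<and> holds_smith_form A S Q s \<and>
        exec B (gmax_gens snf) (load_mat A) t s' \<and>
        read_columns s' (dim_row A) n = scaled_columns S Q \<and>
        generate (QZ n) (QZ_class n ` set (read_columns s' (dim_row A) n)) = Gmax A \<and>
        real t \<le> C * (real (dim_row A) + real n + real_of_int (mat_norm A)) ^ d"
      using s cols gens by blast
  qed
qed

end
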